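(* Let $R$ be a complex superalgebra of type $(1,2)$ which is right alternative and nontrivial. Then $R$ is isomorphic to one of the following superalgebras, written in a homogeneous basis $e_1$ (even), $f_1,f_2$ (odd) by listing their nonzero products (all unlisted products of basis elements are zero): $\mathrm{R}_{01}^{\alpha}$ ($\alpha\neq -1$): $e_1f_1=(1+\alpha)f_2,\ f_1e_1=(1-\alpha)f_2,\ f_1f_2=\frac{2(\alpha-1)}{\alpha+1}e_1,\ f_2f_1=-\frac{4}{\alpha+1}e_1$; $\mathrm{R}_{02}$: $e_1f_1=4f_2,\ f_1e_1=-2f_2,\ f_1f_1=e_1,\ f_1f_2=e_1,\ f_2f_1=-e_1$; $\mathrm{R}_{03}$: $e_1f_1=f_2,\ f_1e_1=-f_2,\ f_1f_2=2e_1$; $\mathrm{R}_{04}^{\alpha}$: $f_1f_2=(\alpha+1)e_1,\ f_2f_1=(\alpha-1)e_1$; $\mathrm{R}_{05}$: $f_1f_2=e_1,\ f_2f_1=-e_1,\ f_2f_2=-e_1$; $\mathrm{R}_{06}^{\alpha}$: $e_1f_1=(1+\alpha)f_2,\ f_1e_1=(1-\alpha)f_2$; $\mathrm{R}_{07}^{\alpha}$: $e_1f_1=(1+\alpha)f_2,\ f_1e_1=(1-\alpha)f_2,\ f_1f_1=e_1$; $\mathrm{R}_{08}$: $f_1e_1=2f_2,\ f_1f_2=e_1,\ f_2f_1=e_1$; $\mathrm{R}_{09}$: $e_1e_1=e_1,\ f_1e_1=f_1$; $\mathrm{R}_{10}$: $e_1e_1=e_1,\ e_1f_1=f_2,\ f_1e_1=f_1-f_2$;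 $\mathrm{R}_{11}$: $e_1e_1=e_1,\ e_1f_1=f_1$; $\mathrm{R}_{12}$: $e_1e_1=e_1,\ e_1f_1=f_1,\ f_1f_1=e_1$; $\mathrm{R}_{13}$: $e_1e_1=e_1,\ e_1f_1=f_1,\ e_1f_2=f_2,\ f_1e_1=f_1$; $\mathrm{R}_{14}$: $e_1e_1=e_1,\ e_1f_1=f_1,\ e_1f_2=f_1+f_2,\ f_1e_1=f_1,\ f_2e_1=-f_1$; $\mathrm{R}_{15}$: $e_1e_1=e_1,\ e_1f_1=f_1,\ f_1e_1=f_1,\ f_2e_1=f_2$; $\mathrm{R}_{16}$: $e_1e_1=e_1,\ e_1f_1=f_1,\ f_1e_1=f_1,\ f_1f_1=e_1,\ f_2e_1=f_2$; $\mathrm{R}_{17}$: $e_1e_1=e_1,\ e_1f_1=f_1,\ f_1e_1=f_1$; $\mathrm{R}_{18}$: $e_1e_1=e_1,\ e_1f_1=f_1,\ f_1e_1=f_1,\ f_1f_1=e_1$; $\mathrm{R}_{19}$: $e_1e_1=e_1$; $\mathrm{R}_{20}$: $e_1e_1=e_1,\ e_1f_1=f_1,\ f_2e_1=f_2$; $\mathrm{R}_{21}$: $e_1e_1=e_1,\ e_1f_1=f_1,\ f_2e_1=f_2,\ f_1f_1=e_1$; $\mathrm{R}_{22}$: $e_1e_1=e_1,\ f_1e_1=f_1,\ f_2e_1=f_2$; $\mathrm{R}_{23}$: $e_1e_1=e_1,\ e_1f_1=f_1,\ e_1f_2=f_2$; $\mathrm{R}_{24}$: $e_1e_1=e_1,\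 e_1f_1=f_1,\ f_1e_1=f_1,\ e_1f_2=f_2,\ f_2e_1=f_2$; $\mathrm{R}_{25}$: $f_1f_2=e_1,\ f_2f_1=e_1$; $\mathrm{R}_{26}$: $f_1f_1=e_1$; $\mathrm{R}_{27}$: $e_1f_1=f_2,\ f_1e_1=-f_2$; $\mathrm{R}_{28}$: $e_1f_1=f_2,\ f_1e_1=-f_2,\ f_1f_1=e_1$. Here $\alpha$ ranges over $\mathbb{C}$ unless restricted. All listed superalgebras are pairwise non-isomorphic, except that $\mathrm{R}_{04}^{\alpha}\cong\mathrm{R}_{04}^{-\alpha}$.
   Context: All algebras are over $\mathbb{C}$. A superalgebra is a $\mathbb{Z}_2$-graded algebra $A=A_0\oplus A_1$ with $A_iA_j\subseteq A_{i+j \bmod 2}$; for a homogeneous element $x$, $|x|\in\{0,1\}$ denotes its degree. It has type $(n,m)$ if $\dim A_0=n$ and $\dim A_1=m$. Isomorphisms of superalgebras are grading-preserving algebra isomorphisms. The associator is $(x,y,z)=(xy)z-x(yz)$. A superalgebra is right alternative if $(x,y,z)=-(-1)^{|y||z|}(x,z,y)$ for all homogeneous $x,y,z$. A superalgebra is trivial if all its products are zero. *)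

theory Defs
  imports Complex_Main "HOL-Library.Function_Algebras"
begin

definition superalgebra ::
  "(complex \<Rightarrow> 'a::ab_group_add \<Rightarrow> 'a) \<Rightarrow> ('a \<Rightarrow> 'a \<Rightarrow> 'a) \<Rightarrow> 'a set \<Rightarrow> 'a set \<Rightarrow> bool" where
  "superalgebra s m A0 A1 \<longleftrightarrow>
     vector_space s \<and>
     module.subspace s A0 \<and> module.subspace s A1 \<and>
     A0 \<inter> A1 = {0} \<and> (\<forall>x. \<exists>a b. a \<in> A0 \<and> b \<in> A1 \<and> x = a + b) \<and>
     (\<forall>x. Vector_Spaces.linear s s (m x)) \<and>
     (\<forall>y. Vector_Spaces.linear s s (\<lambda>x. m x y)) \<and>
     (\<forall>x\<in>A0. \<forall>y\<in>A0. m x y \<in> A0) \<and>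
     (\<forall>x\<in>A0. \<forall>y\<in>A1. m x y \<in> A1) \<and>
     (\<forall>x\<in>A1. \<forall>y\<in>A0. m x y \<in> A1) \<and>
     (\<forall>x\<in>A1. \<forall>y\<in>A1. m x y \<in> A0)"

definition superalgebra_type ::
  "(complex \<Rightarrow> 'a::ab_group_add \<Rightarrow> 'a) \<Rightarrow> ('a \<Rightarrow> 'a \<Rightarrow> 'a) \<Rightarrow> 'a set \<Rightarrow> 'a set \<Rightarrow> nat \<Rightarrow> nat \<Rightarrow> bool" where
  "superalgebra_type s m A0 A1 n k \<longleftrightarrow>
     superalgebra s m A0 A1 \<and> vector_space.dim s A0 = n \<and> vector_space.dim s A1 = k"

definition associator :: "('a \<Rightarrow> 'a \<Rightarrow> 'a) \<Rightarrow> 'a \<Rightarrow> 'a \<Rightarrow> 'a \<Rightarrow> 'a::ab_group_add" where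
  "associator m x y z = m (m x y) z - m x (m y z)"

text \<open>Right alternative: (x,y,z) = -(-1)^(|y||z|) (x,z,y) for homogeneous x,y,z.
The sign is -1 unless y and z are both odd, in which case it is +1.  (For the
element 0, which lies in both A0 and A1, both sides vanish, so the choice of degree
is irrelevant.)\<close>
definition right_alternative :: "('a::ab_group_add \<Rightarrow> 'a \<Rightarrow> 'a) \<Rightarrow> 'a set \<Rightarrow> 'a set \<Rightarrow> bool" where
  "right_alternative m A0 A1 \<longleftrightarrow>
     (\<forall>x\<in>A0 \<union> A1. \<forall>y\<in>A0 \<union> A1. \<forall>z\<in>A0 \<union> A1.
        associator m x y z =
          (if y \<in> A1 \<and> z \<in> A1 then associator m x z y else - associator m x z y))"

definition trivial_product :: "('a::zero \<Rightarrow> 'a \<Rightarrow> 'a) \<Rightarrow> bool" where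
  "trivial_product m \<longleftrightarrow> (\<forall>x y. m x y = 0)"

definition superalgebra_iso ::
  "(complex \<Rightarrow> 'a::ab_group_add \<Rightarrow> 'a) \<Rightarrow> ('a \<Rightarrow> 'a \<Rightarrow> 'a) \<Rightarrow> 'a set \<Rightarrow> 'a set \<Rightarrow>
   (complex \<Rightarrow> 'b::ab_group_add \<Rightarrow> 'b) \<Rightarrow> ('b \<Rightarrow> 'b \<Rightarrow> 'b) \<Rightarrow> 'b set \<Rightarrow> 'b set \<Rightarrow>
   ('a \<Rightarrow> 'b) \<Rightarrow> bool" where
  "superalgebra_iso s1 m1 A0 A1 s2 m2 B0 B1 \<phi> \<longleftrightarrow>
     Vector_Spaces.linear s1 s2 \<phi> \<and> bij \<phi> \<and> \<phi> ` A0 = B0 \<and> \<phi> ` A1 = B1 \<and>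
     (\<forall>x y. \<phi> (m1 x y) = m2 (\<phi> x) (\<phi> y))"

definition superalgebra_isomorphic ::
  "(complex \<Rightarrow> 'a::ab_group_add \<Rightarrow> 'a) \<Rightarrow> ('a \<Rightarrow> 'a \<Rightarrow> 'a) \<Rightarrow> 'a set \<Rightarrow> 'a set \<Rightarrow>
   (complex \<Rightarrow> 'b::ab_group_add \<Rightarrow> 'b) \<Rightarrow> ('b \<Rightarrow> 'b \<Rightarrow> 'b) \<Rightarrow> 'b set \<Rightarrow> 'b set \<Rightarrow> bool" where
  "superalgebra_isomorphic s1 m1 A0 A1 s2 m2 B0 B1 \<longleftrightarrow>
     (\<exists>\<phi>. superalgebra_iso s1 m1 A0 A1 s2 m2 B0 B1 \<phi>)"

datatype b3 = E1 | F1 | F2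

definition cscale :: "complex \<Rightarrow> (b3 \<Rightarrow> complex) \<Rightarrow> (b3 \<Rightarrow> complex)" where
  "cscale c v = (\<lambda>i. c * v i)"

definition even3 :: "(b3 \<Rightarrow> complex) set" where
  "even3 = {v. v F1 = 0 \<and> v F2 = 0}"

definition odd3 :: "(b3 \<Rightarrow> complex) set" where
  "odd3 = {v. v E1 = 0}"

text \<open>A multiplication table is a list of entries (i, j, k, c), meaning that the
product b_i b_j has coefficient (contribution) c at b_k; all products not listed
are zero.\<close>
definition coef :: "(b3 \<times> b3 \<times> b3 \<times> complex) list \<Rightarrow> b3 \<Rightarrow> b3 \<Rightarrow> b3 \<Rightarrow> complex" where
  "coef L i j k = sum_list (map (\<lambda>(i',j',k',c). if i' = i \<and> j' = j \<and> k' = k then c else 0) L)"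

definition tmult :: "(b3 \<times> b3 \<times> b3 \<times> complex) list \<Rightarrow> (b3 \<Rightarrow> complex) \<Rightarrow> (b3 \<Rightarrow> complex) \<Rightarrow> (b3 \<Rightarrow> complex)" where
  "tmult L u v = (\<lambda>k. \<Sum>i\<in>{E1,F1,F2}. \<Sum>j\<in>{E1,F1,F2}. u i * v j * coef L i j k)"

datatype cls = R01 | R02 | R03 | R04 | R05 | R06 | R07 | R08 | R09 | R10
  | R11 | R12 | R13 | R14 | R15 | R16 | R17 | R18 | R19 | R20
  | R21 | R22 | R23 | R24 | R25 | R26 | R27 | R28

definition param_family :: "cls \<Rightarrow> bool" where
  "param_family c \<longleftrightarrow> c \<in> {R01, R04, R06, R07}"

text \<open>Admissible (class, parameter) pairs; for non-param_family classes the parameter is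
a dummy normalised to 0.\<close>
definition admissible :: "cls \<Rightarrow> complex \<Rightarrow> bool" where
  "admissible c \<alpha> \<longleftrightarrow> (c = R01 \<longrightarrow> \<alpha> \<noteq> -1) \<and> (\<not> param_family c \<longrightarrow> \<alpha> = 0)"

fun table :: "cls \<Rightarrow> complex \<Rightarrow> (b3 \<times> b3 \<times> b3 \<times> complex) list" where
  "table R01 \<alpha> = [(E1,F1,F2, 1+\<alpha>), (F1,E1,F2, 1-\<alpha>),
                   (F1,F2,E1, 2*(\<alpha>-1)/(\<alpha>+1)), (F2,F1,E1, -(4/(\<alpha>+1)))]"
| "table R02 \<alpha> = [(E1,F1,F2, 4), (F1,E1,F2, -2), (F1,F1,E1, 1), (F1,F2,E1, 1), (F2,F1,E1, -1)]"
| "table R03 \<alpha> = [(E1,F1,F2, 1), (F1,E1,F2, -1), (F1,F2,E1, 2)]"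
| "table R04 \<alpha> = [(F1,F2,E1, \<alpha>+1), (F2,F1,E1, \<alpha>-1)]"
| "table R05 \<alpha> = [(F1,F2,E1, 1), (F2,F1,E1, -1), (F2,F2,E1, -1)]"
| "table R06 \<alpha> = [(E1,F1,F2, 1+\<alpha>), (F1,E1,F2, 1-\<alpha>)]"
| "table R07 \<alpha> = [(E1,F1,F2, 1+\<alpha>), (F1,E1,F2, 1-\<alpha>), (F1,F1,E1, 1)]"
| "table R08 \<alpha> = [(F1,E1,F2, 2), (F1,F2,E1, 1), (F2,F1,E1, 1)]"
| "table R09 \<alpha> = [(E1,E1,E1, 1), (F1,E1,F1, 1)]"
| "table R10 \<alpha> = [(E1,E1,E1, 1), (E1,F1,F2, 1), (F1,E1,F1, 1), (F1,E1,F2, -1)]"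
| "table R11 \<alpha> = [(E1,E1,E1, 1), (E1,F1,F1, 1)]"
| "table R12 \<alpha> = [(E1,E1,E1, 1), (E1,F1,F1, 1), (F1,F1,E1, 1)]"
| "table R13 \<alpha> = [(E1,E1,E1, 1), (E1,F1,F1, 1), (E1,F2,F2, 1), (F1,E1,F1, 1)]"
| "table R14 \<alpha> = [(E1,E1,E1, 1), (E1,F1,F1, 1), (E1,F2,F1, 1), (E1,F2,F2, 1),
                   (F1,E1,F1, 1), (F2,E1,F1, -1)]"
| "table R15 \<alpha> = [(E1,E1,E1, 1), (E1,F1,F1, 1), (F1,E1,F1, 1), (F2,E1,F2, 1)]"
| "table R16 \<alpha> = [(E1,E1,E1, 1), (E1,F1,F1, 1), (F1,E1,F1, 1), (F1,F1,E1, 1), (F2,E1,F2, 1)]"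
| "table R17 \<alpha> = [(E1,E1,E1, 1), (E1,F1,F1, 1), (F1,E1,F1, 1)]"
| "table R18 \<alpha> = [(E1,E1,E1, 1), (E1,F1,F1, 1), (F1,E1,F1, 1), (F1,F1,E1, 1)]"
| "table R19 \<alpha> = [(E1,E1,E1, 1)]"
| "table R20 \<alpha> = [(E1,E1,E1, 1), (E1,F1,F1, 1), (F2,E1,F2, 1)]"
| "table R21 \<alpha> = [(E1,E1,E1, 1), (E1,F1,F1, 1), (F2,E1,F2, 1), (F1,F1,E1, 1)]"
| "table R22 \<alpha> = [(E1,E1,E1, 1), (F1,E1,F1, 1), (F2,E1,F2, 1)]"
| "table R23 \<alpha> = [(E1,E1,E1, 1), (E1,F1,F1, 1), (E1,F2,F2, 1)]"
| "table R24 \<alpha> = [(E1,E1,E1, 1), (E1,F1,F1, 1), (F1,E1,F1, 1), (E1,F2,F2, 1), (F2,E1,F2, 1)]"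
| "table R25 \<alpha> = [(F1,F2,E1, 1), (F2,F1,E1, 1)]"
| "table R26 \<alpha> = [(F1,F1,E1, 1)]"
| "table R27 \<alpha> = [(E1,F1,F2, 1), (F1,E1,F2, -1)]"
| "table R28 \<alpha> = [(E1,F1,F2, 1), (F1,E1,F2, -1), (F1,F1,E1, 1)]"

definition Rmult :: "cls \<Rightarrow> complex \<Rightarrow> (b3 \<Rightarrow> complex) \<Rightarrow> (b3 \<Rightarrow> complex) \<Rightarrow> (b3 \<Rightarrow> complex)" where
  "Rmult c \<alpha> = tmult (table c \<alpha>)"

end

theory Submission
  imports Defs
begin

text \<open>Let \<open>e\<close> span the even part, write \<open>e e = \<epsilon> e\<close> and \<open>f g = B(f,g) e\<close> for odd \<open>f\<close>, \<open>g\<close>, and let \<open>L\<close>, \<open>R\<close> be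
  the left and right multiplication by \<open>e\<close> on the odd part. After scaling \<open>e\<close>, \<open>\<epsilon>\<close> is \<open>0\<close> or \<open>1\<close>.
  Right alternativity gives \<open>R\<^sup>2 = \<epsilon> R\<close> and \<open>\<epsilon> L - L\<^sup>2 + R L - L R = 0\<close>, so \<open>R\<close> is idempotent or nilpotent,
  and if \<open>R\<close> is scalar then \<open>L\<close> is idempotent or nilpotent too. In a basis putting these operators in normal form, the
  remaining identities are linear in \<open>B\<close>, and a further change of basis normalises \<open>B\<close>.
  The classes are separated by \<open>\<epsilon>\<close>, the linear relations between \<open>L\<close>, \<open>R\<close> and \<open>\<epsilon> I\<close>, the trace of \<open>L\<close>,
  the vanishing of the symmetric and of the alternating part of \<open>B\<close>, and the discriminant of \<open>B\<close>.\<close>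

section \<open>Isomorphisms\<close>

lemma superalgebra_isomorphic_sym:
  assumes "superalgebra_isomorphic s1 m1 A0 A1 s2 m2 B0 B1"
  shows "superalgebra_isomorphic s2 m2 B0 B1 s1 m1 A0 A1"
proof -
  obtain \<phi> where \<phi>: "Vector_Spaces.linear s1 s2 \<phi>" "bij \<phi>" "\<phi> ` A0 = B0" "\<phi> ` A1 = B1"
      "\<And>x y. \<phi> (m1 x y) = m2 (\<phi> x) (\<phi> y)"
    using assms unfolding superalgebra_isomorphic_def superalgebra_iso_def by blast
  interpret l: Vector_Spaces.linear s1 s2 \<phi> by (rule \<phi>)
  let ?g = "inv \<phi>"
  have fg: "\<phi> (?g y) = y" and gf: "?g (\<phi> x) = x" for x y
    using \<phi>(2) by (simp_all add: bij_is_surj surj_f_inv_f bij_is_inj)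
  have eqI: "u = v" if "\<phi> u = \<phi> v" for u v
    using that \<phi>(2) by (simp add: bij_is_inj inj_eq)
  have "Vector_Spaces.linear s2 s1 ?g"
    by unfold_locales (auto intro!: eqI simp: fg l.add l.scale)
  moreover have "bij ?g"
    using \<phi>(2) by (rule bij_imp_bij_inv)
  moreover have "?g ` B0 = A0" "?g ` B1 = A1"
    using \<phi>(2-4) by (auto simp: image_inv_f_f bij_is_inj)
  moreover have "?g (m2 x y) = m1 (?g x) (?g y)" for x y
    by (intro eqI) (simp add: \<phi>(5) fg)
  ultimately show ?thesis
    unfolding superalgebra_isomorphic_def superalgebra_iso_def by blast
qed

lemma superalgebra_isomorphic_trans:
  assumes "superalgebra_isomorphic s1 m1 A0 A1 s2 m2 B0 B1"
    and "superalgebra_isomorphic s2 m2 B0 B1 s3 m3 C0 C1"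
  shows "superalgebra_isomorphic s1 m1 A0 A1 s3 m3 C0 C1"
proof -
  obtain \<phi> where \<phi>: "superalgebra_iso s1 m1 A0 A1 s2 m2 B0 B1 \<phi>"
    using assms(1) unfolding superalgebra_isomorphic_def by blast
  obtain \<psi> where \<psi>: "superalgebra_iso s2 m2 B0 B1 s3 m3 C0 C1 \<psi>"
    using assms(2) unfolding superalgebra_isomorphic_def by blast
  have "superalgebra_iso s1 m1 A0 A1 s3 m3 C0 C1 (\<psi> \<circ> \<phi>)"
    using \<phi> \<psi> unfolding superalgebra_iso_def
    by (auto simp: image_comp[symmetric] intro: bij_comp Vector_Spaces.linear_compose)
  then show ?thesis
    unfolding superalgebra_isomorphic_def by blast
qed

text \<open>Transfers the identity from the given algebra to its coordinate model. Associators and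
  degrees are respected by \<open>\<phi>\<close>, and injectivity reflects the resulting
  equation.\<close>

lemma right_alternative_iso:
  assumes iso: "superalgebra_iso s1 m1 A0 A1 s2 m2 B0 B1 \<phi>"
    and ra: "right_alternative m2 B0 B1"
  shows "right_alternative m1 A0 A1"
proof -
  have \<phi>: "Vector_Spaces.linear s1 s2 \<phi>" "inj \<phi>" "\<phi> ` A0 = B0" "\<phi> ` A1 = B1"
      "\<And>x y. \<phi> (m1 x y) = m2 (\<phi> x) (\<phi> y)"
    using iso unfolding superalgebra_iso_def by (auto simp: bij_is_inj)
  interpret l: Vector_Spaces.linear s1 s2 \<phi> by (rule \<phi>)
  have assoc: "\<phi> (associator m1 x y z) = associator m2 (\<phi> x) (\<phi> y) (\<phi> z)" for x y z
    by (simp add: associator_def l.diff \<phi>(5))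
  show ?thesis
    unfolding right_alternative_def
  proof (intro ballI)
    fix x y z assume xyz: "x \<in> A0 \<union> A1" "y \<in> A0 \<union> A1" "z \<in> A0 \<union> A1"
    then have "\<phi> x \<in> B0 \<union> B1" "\<phi> y \<in> B0 \<union> B1" "\<phi> z \<in> B0 \<union> B1"
      using \<phi>(3,4) by auto
    with ra have "associator m2 (\<phi> x) (\<phi> y) (\<phi> z) =
        (if \<phi> y \<in> B1 \<and> \<phi> z \<in> B1 then associator m2 (\<phi> x) (\<phi> z) (\<phi> y)
         else - associator m2 (\<phi> x) (\<phi> z) (\<phi> y))"
      unfolding right_alternative_def by blast
    moreover have "\<phi> w \<in> B1 \<longleftrightarrow> w \<in> A1" for w
      using \<phi>(2,4) by (metis inj_image_mem_iff)
    ultimately have "\<phi> (associator m1 x y z) = \<phi> (if y \<in> A1 \<and> z \<in> A1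
        then associator m1 x z y else - associator m1 x z y)"
      by (simp add: assoc l.neg)
    then show "associator m1 x y z = (if y \<in> A1 \<and> z \<in> A1
        then associator m1 x z y else - associator m1 x z y)"
      using \<phi>(2) by (simp add: inj_eq)
  qed
qed

section \<open>Structure constants\<close>

lemma all_b3: "(\<forall>k. P k) \<longleftrightarrow> P E1 \<and> P F1 \<and> P F2"
  by (metis b3.exhaust)

lemma fun_eq_b3: "f = g \<longleftrightarrow> f E1 = g E1 \<and> f F1 = g F1 \<and> f F2 = g F2"
  by (auto simp: fun_eq_iff all_b3)

text \<open>The product of \<open>tmult\<close> for arbitrary structure constants, so that an
  abstract algebra in a chosen basis and the listed tables are treated alike.\<close>

definition cmult :: "(b3 \<Rightarrow> b3 \<Rightarrow> b3 \<Rightarrow> complex) \<Rightarrow> (b3 \<Rightarrow> complex) \<Rightarrow> (b3 \<Rightarrow> complex) \<Rightarrow> b3 \<Rightarrow> complex"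
  where "cmult c u v = (\<lambda>k. \<Sum>i\<in>{E1,F1,F2}. \<Sum>j\<in>{E1,F1,F2}. u i * v j * c i j k)"

lemma Rmult_eq_cmult: "Rmult a \<alpha> = cmult (coef (table a \<alpha>))"
  by (simp add: fun_eq_iff Rmult_def tmult_def cmult_def)

lemma cmult_expand: "cmult c u v k =
    u E1 * v E1 * c E1 E1 k + u E1 * v F1 * c E1 F1 k + u E1 * v F2 * c E1 F2 k +
    u F1 * v E1 * c F1 E1 k + u F1 * v F1 * c F1 F1 k + u F1 * v F2 * c F1 F2 k +
    u F2 * v E1 * c F2 E1 k + u F2 * v F1 * c F2 F1 k + u F2 * v F2 * c F2 F2 k"
  by (simp add: cmult_def)

definition graded :: "(b3 \<Rightarrow> b3 \<Rightarrow> b3 \<Rightarrow> complex) \<Rightarrow> bool" where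
  "graded c \<longleftrightarrow> c E1 E1 \<in> even3 \<and>
     (\<forall>i\<in>{F1,F2}. c E1 i \<in> odd3 \<and> c i E1 \<in> odd3 \<and> (\<forall>j\<in>{F1,F2}. c i j \<in> even3))"

text \<open>Parity kills fourteen of the 27 structure constants; the other thirteen are the ones
  compared in \<open>base_change\<close>.\<close>

lemma gradedD:
  assumes "graded c"
  shows "c E1 E1 F1 = 0" "c E1 E1 F2 = 0" "c E1 F1 E1 = 0" "c E1 F2 E1 = 0"
    "c F1 E1 E1 = 0" "c F2 E1 E1 = 0" "c F1 F1 F1 = 0" "c F1 F1 F2 = 0" "c F1 F2 F1 = 0"
    "c F1 F2 F2 = 0" "c F2 F1 F1 = 0" "c F2 F1 F2 = 0" "c F2 F2 F1 = 0" "c F2 F2 F2 = 0"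
  using assms by (auto simp: graded_def even3_def odd3_def)

lemma graded_table: "graded (coef (table a \<alpha>))"
  by (cases a) (auto simp: graded_def even3_def odd3_def coef_def)

lemma vector_space_cscale: "vector_space cscale"
  by unfold_locales (auto simp: cscale_def fun_eq_iff algebra_simps)

lemma superalgebra_cmult:
  assumes "graded c"
  shows "superalgebra cscale (cmult c) even3 odd3"
proof -
  interpret vector_space cscale by (rule vector_space_cscale)
  note g = gradedD[OF assms]
  have "Vector_Spaces.linear cscale cscale (cmult c x)"
       "Vector_Spaces.linear cscale cscale (\<lambda>y. cmult c y x)" for x
    by unfold_locales (auto simp: cmult_expand cscale_def fun_eq_iff algebra_simps)
  moreover have "\<exists>a b. a \<in> even3 \<and> b \<in> odd3 \<and> x = a + b" for x
    by (rule exI[of _ "x(F1 := 0, F2 := 0)"], rule exI[of _ "x(E1 := 0)"])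
      (simp add: even3_def odd3_def fun_eq_b3)
  moreover have "even3 \<inter> odd3 = {0}"
    by (auto simp: even3_def odd3_def fun_eq_b3)
  moreover have "subspace even3" "subspace odd3"
    by (auto simp: subspace_def even3_def odd3_def cscale_def)
  ultimately show ?thesis
    unfolding superalgebra_def using vector_space_cscale
    by (auto simp: cmult_expand even3_def odd3_def g)
qed

definition bas :: "b3 \<Rightarrow> b3 \<Rightarrow> complex" where
  "bas i = (\<lambda>k. if k = i then 1 else 0)"

lemma bas_simps [simp]: "bas i i = 1" "i \<noteq> j \<Longrightarrow> bas i j = 0"
  by (auto simp: bas_def)

lemma cmult_bas: "cmult c (bas i) (bas j) = c i j"
  by (cases i; cases j) (simp_all add: cmult_expand fun_eq_iff)

definition comb :: "(complex \<Rightarrow> 'a::ab_group_add \<Rightarrow> 'a) \<Rightarrow> (b3 \<Rightarrow> 'a) \<Rightarrow> (b3 \<Rightarrow> complex) \<Rightarrow> 'a" where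
  "comb s v u = s (u E1) (v E1) + s (u F1) (v F1) + s (u F2) (v F2)"

text \<open>A homogeneous basis, phrased without \<open>span\<close> so that coordinates can be read
  off directly.\<close>

definition frame :: "(complex \<Rightarrow> 'a::ab_group_add \<Rightarrow> 'a) \<Rightarrow> 'a set \<Rightarrow> 'a set \<Rightarrow> (b3 \<Rightarrow> 'a) \<Rightarrow> bool" where
  "frame s A0 A1 v \<longleftrightarrow> A0 = {s a (v E1) | a. True} \<and> A1 = {s a (v F1) + s b (v F2) | a b. True} \<and>
     (\<forall>u. comb s v u = 0 \<longrightarrow> u = 0)"

text \<open>By bilinearity, multiplicativity need only be known on the nine products of basis
  vectors. Applied to the given algebra this yields structure constants; applied to
  \<open>cmult c\<close> it yields a change of basis.\<close>

lemma comb_iso: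
  assumes sa: "superalgebra s m A0 A1" and fr: "frame s A0 A1 v"
    and mult: "\<And>i j. m (v i) (v j) = comb s v (c i j)"
  shows "superalgebra_iso cscale (cmult c) even3 odd3 s m A0 A1 (comb s v)"
proof -
  interpret V: vector_space s using sa by (simp add: superalgebra_def)
  interpret C: vector_space cscale by (rule vector_space_cscale)
  have lin: "Vector_Spaces.linear cscale s (comb s v)"
    by unfold_locales (simp_all add: comb_def cscale_def V.scale_left_distrib V.scale_right_distrib)
  then interpret l: Vector_Spaces.linear cscale s "comb s v" .
  have "inj (comb s v)"
    using fr by (simp add: l.inj_iff_eq_0 frame_def)
  moreover have surj: "\<exists>u. x = comb s v u" for x
  proof -
    obtain a b where "a \<in> A0" "b \<in> A1" "x = a + b"
      using sa unfolding superalgebra_def by blast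
    moreover obtain p where "a = s p (v E1)"
      using \<open>a \<in> A0\<close> fr by (auto simp: frame_def)
    moreover obtain q r where "b = s q (v F1) + s r (v F2)"
      using \<open>b \<in> A1\<close> fr by (auto simp: frame_def)
    ultimately have "x = comb s v (case_b3 p q r)"
      by (simp add: comb_def add.assoc)
    then show ?thesis by blast
  qed
  moreover have "comb s v ` even3 = A0"
  proof -
    have "comb s v ` even3 = {s a (v E1) | a. True}"
    proof (intro set_eqI iffI)
      fix x assume "x \<in> {s a (v E1) | a. True}"
      then obtain a where "x = s a (v E1)" by blast
      then have "x = comb s v (case_b3 a 0 0)" by (simp add: comb_def)
      then show "x \<in> comb s v ` even3" by (auto intro!: imageI simp: even3_def)
    qed (auto simp: comb_def even3_def)
    then show ?thesis using fr by (simp add: frame_def)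
  qed
  moreover have "comb s v ` odd3 = A1"
  proof -
    have "comb s v ` odd3 = {s a (v F1) + s b (v F2) | a b. True}"
    proof (intro set_eqI iffI)
      fix x assume "x \<in> {s a (v F1) + s b (v F2) | a b. True}"
      then obtain a b where "x = s a (v F1) + s b (v F2)" by blast
      then have "x = comb s v (case_b3 0 a b)" by (simp add: comb_def)
      then show "x \<in> comb s v ` odd3" by (auto intro!: imageI simp: odd3_def)
    qed (auto simp: comb_def odd3_def)
    then show ?thesis using fr by (simp add: frame_def)
  qed
  moreover have "comb s v (cmult c x y) = m (comb s v x) (comb s v y)" for x y
  proof -
    have linl: "Vector_Spaces.linear s s (\<lambda>x. m x y)" and linr: "Vector_Spaces.linear s s (m y)" for y
      using sa by (auto simp: superalgebra_def)
    interpret ml: Vector_Spaces.linear s s "\<lambda>x. m x z" for z by (rule linl)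
    interpret mr: Vector_Spaces.linear s s "m z" for z by (rule linr)
    have "m (comb s v x) (comb s v y) =
      (\<Sum>i\<in>{E1,F1,F2}. \<Sum>j\<in>{E1,F1,F2}. s (x i * y j) (m (v i) (v j)))"
      by (simp add: comb_def[of _ _ x] comb_def[of _ _ y] ml.add ml.scale mr.add mr.scale
          V.scale_right_distrib add_ac mult.commute)
    also have "\<dots> = comb s v (cmult c x y)"
      by (simp add: mult comb_def cmult_def V.scale_left_distrib V.scale_right_distrib add_ac)
    finally show ?thesis ..
  qed
  ultimately show ?thesis
    unfolding superalgebra_iso_def bij_def surj_def using lin by blast
qed

text \<open>\<open>d\<close> are the structure constants of \<open>cmult c\<close> in the basis \<open>x e\<^sub>1\<close>, \<open>p f\<^sub>1 + q f\<^sub>2\<close>, \<open>r f\<^sub>1 + t f\<^sub>2\<close>.\<close>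
definition base_change :: "(b3 \<Rightarrow> b3 \<Rightarrow> b3 \<Rightarrow> complex) \<Rightarrow> (b3 \<Rightarrow> b3 \<Rightarrow> b3 \<Rightarrow> complex) \<Rightarrow>
    complex \<Rightarrow> complex \<Rightarrow> complex \<Rightarrow> complex \<Rightarrow> complex \<Rightarrow> bool" where
  "base_change c d x p q r t \<longleftrightarrow> x \<noteq> 0 \<and> p * t \<noteq> q * r \<and>
    x * c E1 E1 E1 = d E1 E1 E1 \<and>
    x * (p * c E1 F1 F1 + q * c E1 F2 F1) = p * d E1 F1 F1 + r * d E1 F1 F2 \<and>
    x * (p * c E1 F1 F2 + q * c E1 F2 F2) = q * d E1 F1 F1 + t * d E1 F1 F2 \<and>
    x * (r * c E1 F1 F1 + t * c E1 F2 F1) = p * d E1 F2 F1 + r * d E1 F2 F2 \<and>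
    x * (r * c E1 F1 F2 + t * c E1 F2 F2) = q * d E1 F2 F1 + t * d E1 F2 F2 \<and>
    x * (p * c F1 E1 F1 + q * c F2 E1 F1) = p * d F1 E1 F1 + r * d F1 E1 F2 \<and>
    x * (p * c F1 E1 F2 + q * c F2 E1 F2) = q * d F1 E1 F1 + t * d F1 E1 F2 \<and>
    x * (r * c F1 E1 F1 + t * c F2 E1 F1) = p * d F2 E1 F1 + r * d F2 E1 F2 \<and>
    x * (r * c F1 E1 F2 + t * c F2 E1 F2) = q * d F2 E1 F1 + t * d F2 E1 F2 \<and>
    p * p * c F1 F1 E1 + p * q * (c F1 F2 E1 + c F2 F1 E1) + q * q * c F2 F2 E1 = x * d F1 F1 E1 \<and>
    p * r * c F1 F1 E1 + p * t * c F1 F2 E1 + q * r * c F2 F1 E1 + q * t * c F2 F2 E1 = x * d F1 F2 E1 \<and>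
    p * r * c F1 F1 E1 + r * q * c F1 F2 E1 + t * p * c F2 F1 E1 + q * t * c F2 F2 E1 = x * d F2 F1 E1 \<and>
    r * r * c F1 F1 E1 + r * t * (c F1 F2 E1 + c F2 F1 E1) + t * t * c F2 F2 E1 = x * d F2 F2 E1"

text \<open>The number \<open>p * t - q * r\<close> is the determinant of the odd block, and
  Cramer's rule gives the coordinates.\<close>

lemma frame_cscaleI:
  assumes "x \<noteq> 0" "p * t \<noteq> q * r"
  shows "frame cscale even3 odd3 (case_b3 (case_b3 x 0 0) (case_b3 0 p q) (case_b3 0 r t))"
proof -
  have "u \<in> even3 \<longleftrightarrow> (\<exists>a. u = cscale a (case_b3 x 0 0))" for u
  proof
    assume "u \<in> even3"
    then have "u = cscale (u E1 / x) (case_b3 x 0 0)"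
      using assms by (simp add: fun_eq_b3 cscale_def even3_def)
    then show "\<exists>a. u = cscale a (case_b3 x 0 0)" ..
  qed (auto simp: even3_def cscale_def)
  moreover have "u \<in> odd3 \<longleftrightarrow> (\<exists>a b. u = cscale a (case_b3 0 p q) + cscale b (case_b3 0 r t))" for u
  proof
    assume "u \<in> odd3"
    moreover have "p * t - q * r \<noteq> 0" using assms by simp
    ultimately have "u = cscale ((t * u F1 - r * u F2) / (p * t - q * r)) (case_b3 0 p q) +
        cscale ((p * u F2 - q * u F1) / (p * t - q * r)) (case_b3 0 r t)"
      by (simp add: fun_eq_b3 cscale_def odd3_def add_divide_distrib[symmetric] eq_divide_eq)
         (simp add: algebra_simps)
    then show "\<exists>a b. u = cscale a (case_b3 0 p q) + cscale b (case_b3 0 r t)" by blast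
  qed (auto simp: odd3_def cscale_def)
  moreover have "u = 0" if "comb cscale (case_b3 (case_b3 x 0 0) (case_b3 0 p q) (case_b3 0 r t)) u = 0" for u
  proof -
    have e: "u E1 = 0" and 1: "u F1 * p + u F2 * r = 0" and 2: "u F1 * q + u F2 * t = 0"
      using that assms by (simp_all add: fun_eq_b3 comb_def cscale_def)
    from 1 2 have "(p * t - q * r) * u F1 = 0" "(p * t - q * r) * u F2 = 0" by algebra+
    with e assms show ?thesis by (simp add: fun_eq_b3)
  qed
  ultimately show ?thesis unfolding frame_def by (intro conjI allI impI set_eqI) simp_all
qed

text \<open>With the new basis of \<open>cmult c\<close> as frame, \<open>comb_iso\<close> gives a
  map from \<open>cmult d\<close> to \<open>cmult c\<close>; symmetry turns it around.\<close>

lemma base_change_imp_iso: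
  assumes "graded c" "graded d" "base_change c d x p q r t"
  shows "superalgebra_isomorphic cscale (cmult c) even3 odd3 cscale (cmult d) even3 odd3"
proof -
  let ?v = "case_b3 (case_b3 x 0 0) (case_b3 0 p q) (case_b3 0 r t)"
  have b: "x \<noteq> 0" "p * t \<noteq> q * r" 
    using assms(3) by (simp_all add: base_change_def)
  have "cmult c (?v i) (?v j) = comb cscale ?v (d i j)" for i j
    using assms(3)
    by (cases i; cases j) (simp_all add: fun_eq_b3 cmult_expand comb_def cscale_def
        gradedD[OF assms(1)] gradedD[OF assms(2)] base_change_def algebra_simps)
  then show ?thesis
    using comb_iso[OF superalgebra_cmult[OF assms(1)] frame_cscaleI[OF b]]
    unfolding superalgebra_isomorphic_def by (blast intro: superalgebra_isomorphic_sym[unfolded superalgebra_isomorphic_def])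
qed

text \<open>A graded isomorphism has a block diagonal matrix, with entry \<open>x\<close> on the
  even part and rows \<open>(p, q)\<close>, \<open>(r, t)\<close> on the odd part. The inverse map
  is used, since the images of the standard basis have to lie in \<open>cmult c\<close>.\<close>

lemma iso_imp_base_change:
  assumes "graded c" "graded d"
    and "superalgebra_isomorphic cscale (cmult c) even3 odd3 cscale (cmult d) even3 odd3"
  obtains x p q r t where "base_change c d x p q r t"
proof -
  obtain \<phi> where "superalgebra_iso cscale (cmult d) even3 odd3 cscale (cmult c) even3 odd3 \<phi>"
    using superalgebra_isomorphic_sym[OF assms(3)] unfolding superalgebra_isomorphic_def by blast
  then have \<phi>: "Vector_Spaces.linear cscale cscale \<phi>" "\<phi> ` even3 = even3" "\<phi> ` odd3 = odd3"
      "\<And>u v. \<phi> (cmult d u v) = cmult c (\<phi> u) (\<phi> v)"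
    unfolding superalgebra_iso_def by auto
  interpret l: Vector_Spaces.linear cscale cscale \<phi> by (rule \<phi>)
  define v where "v i = \<phi> (bas i)" for i
  have \<phi>_eq: "\<phi> u = comb cscale v u" for u
  proof -
    have "u = comb cscale bas u"
      by (simp add: fun_eq_b3 comb_def cscale_def)
    then have "\<phi> u = \<phi> (comb cscale bas u)" by simp
    then show ?thesis by (simp add: comb_def v_def l.add l.scale)
  qed
  have "bas E1 \<in> even3" "bas F1 \<in> odd3" "bas F2 \<in> odd3"
    by (simp_all add: even3_def odd3_def)
  with \<phi>(2,3) have v0: "v E1 \<in> even3" "v F1 \<in> odd3" "v F2 \<in> odd3"
    unfolding v_def by blast+
  obtain x p q r t where v: "v E1 = case_b3 x 0 0" "v F1 = case_b3 0 p q" "v F2 = case_b3 0 r t"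
  proof
    show "v E1 = case_b3 (v E1 E1) 0 0" "v F1 = case_b3 0 (v F1 F1) (v F1 F2)"
      "v F2 = case_b3 0 (v F2 F1) (v F2 F2)"
      using v0 by (simp_all add: fun_eq_b3 even3_def odd3_def)
  qed
  have mult: "cmult c (v i) (v j) = comb cscale v (d i j)" for i j
  proof -
    have "cmult c (v i) (v j) = \<phi> (d i j)"
      using \<phi>(4)[of "bas i" "bas j"] by (simp add: cmult_bas v_def)
    then show ?thesis by (simp add: \<phi>_eq)
  qed
  \<comment> \<open>Surjectivity makes both blocks invertible: otherwise \<open>bas E1\<close>, or
    one of \<open>bas F1\<close> and \<open>bas F2\<close>, has no preimage.\<close>
  have "x \<noteq> 0"
  proof
    assume "x = 0"
    moreover obtain u where "u \<in> even3" "\<phi> u = bas E1"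
      using \<phi>(2) \<open>bas E1 \<in> even3\<close> by (metis imageE)
    ultimately show False
      by (auto simp: \<phi>_eq comb_def cscale_def v even3_def fun_eq_b3)
  qed
  moreover have "p * t \<noteq> q * r"
  proof
    assume eq: "p * t = q * r"
    obtain u where u: "u \<in> odd3" "\<phi> u = bas F1"
      using \<phi>(3) \<open>bas F1 \<in> odd3\<close> by (metis imageE)
    obtain w where w: "w \<in> odd3" "\<phi> w = bas F2"
      using \<phi>(3) \<open>bas F2 \<in> odd3\<close> by (metis imageE)
    have "u F1 * p + u F2 * r = 1" "u F1 * q + u F2 * t = 0"
         "w F1 * p + w F2 * r = 0" "w F1 * q + w F2 * t = 1"
      using u w by (auto simp: \<phi>_eq comb_def cscale_def v odd3_def fun_eq_b3)
    with eq show False by algebra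
  qed
  moreover have "cmult c (v i) (v j) k = comb cscale v (d i j) k" for i j k
    using mult by simp
  note this[of E1 E1 E1] this[of E1 F1 F1] this[of E1 F1 F2] this[of E1 F2 F1] this[of E1 F2 F2]
    this[of F1 E1 F1] this[of F1 E1 F2] this[of F2 E1 F1] this[of F2 E1 F2]
    this[of F1 F1 E1] this[of F1 F2 E1] this[of F2 F1 E1] this[of F2 F2 E1]
  ultimately have "base_change c d x p q r t"
    by (simp add: v cmult_expand comb_def cscale_def
        gradedD[OF assms(1)] gradedD[OF assms(2)] base_change_def algebra_simps)
  then show ?thesis by (rule that)
qed

section \<open>Right alternative structure constants\<close>

lemma associator_bas: "associator (cmult c) (bas i) (bas j) (bas k) l =
    c i j E1 * c E1 k l + c i j F1 * c F1 k l + c i j F2 * c F2 k l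
    - (c j k E1 * c i E1 l + c j k F1 * c i F1 l + c j k F2 * c i F2 l)"
  by (cases i; cases j; cases k) (simp_all add: associator_def cmult_bas cmult_expand)

lemma bas_homogeneous: "bas i \<in> even3 \<union> odd3" "bas i \<in> odd3 \<longleftrightarrow> i \<noteq> E1"
  by (cases i; simp add: even3_def odd3_def)+

locale right_alternative_constants =
  fixes c :: "b3 \<Rightarrow> b3 \<Rightarrow> b3 \<Rightarrow> complex"
  assumes graded: "graded c" and right_alt: "right_alternative (cmult c) even3 odd3"
begin

lemmas zero = gradedD[OF graded]

lemma assoc_swap: "associator (cmult c) (bas i) (bas j) (bas k) =
    (if j \<noteq> E1 \<and> k \<noteq> E1 then associator (cmult c) (bas i) (bas k) (bas j)
     else - associator (cmult c) (bas i) (bas k) (bas j))"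
  using right_alt bas_homogeneous(1) unfolding right_alternative_def bas_homogeneous(2)[symmetric]
  by blast

lemma assoc_skew: "j = E1 \<or> k = E1 \<Longrightarrow>
    associator (cmult c) (bas i) (bas j) (bas k) l + associator (cmult c) (bas i) (bas k) (bas j) l = 0"
  by (subst assoc_swap) auto

lemma assoc_sym: "j \<noteq> E1 \<Longrightarrow> k \<noteq> E1 \<Longrightarrow>
    associator (cmult c) (bas i) (bas j) (bas k) l = associator (cmult c) (bas i) (bas k) (bas j) l"
  by (subst assoc_swap) simp

text \<open>The identity \<open>(e,e,f) + (e,f,e) = 0\<close>, that is
  \<open>\<epsilon> L - L L + R L - L R = 0\<close>, entry by entry.\<close>

lemma e_e_f:
  assumes "j \<noteq> E1" "l \<noteq> E1"
  shows "c E1 E1 E1 * c E1 j l - (c E1 j F1 * c E1 F1 l + c E1 j F2 * c E1 F2 l)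
    + (c E1 j F1 * c F1 E1 l + c E1 j F2 * c F2 E1 l)
    - (c j E1 F1 * c E1 F1 l + c j E1 F2 * c E1 F2 l) = 0"
  using assoc_skew[of E1 j E1 l] assms
  by (cases j; cases l) (simp_all add: associator_bas zero algebra_simps)

text \<open>From \<open>(g,e,f) + (g,f,e) = 0\<close>: it reads
  \<open>B(R g, f) - B(g, L f) + \<epsilon> B(g, f) - B(g, R f) = 0\<close>.\<close>

lemma g_e_f:
  assumes "g \<noteq> E1" "f \<noteq> E1"
  shows "c g E1 F1 * c F1 f E1 + c g E1 F2 * c F2 f E1
    - (c E1 f F1 * c g F1 E1 + c E1 f F2 * c g F2 E1) + c E1 E1 E1 * c g f E1
    - (c f E1 F1 * c g F1 E1 + c f E1 F2 * c g F2 E1) = 0"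
  using assoc_skew[of E1 f g E1] assms
  by (cases g; cases f) (simp_all add: associator_bas zero algebra_simps)

text \<open>From \<open>(e,f1,f2) = (e,f2,f1)\<close>, where the sign is plus because both swapped
  arguments are odd.\<close>

lemma e_f_g: "c E1 F1 F1 * c F1 F2 E1 + c E1 F1 F2 * c F2 F2 E1 - c E1 E1 E1 * c F1 F2 E1 =
    c E1 F2 F1 * c F1 F1 E1 + c E1 F2 F2 * c F2 F1 E1 - c E1 E1 E1 * c F2 F1 E1"
  using assoc_sym[of F1 F2 E1 E1]
  by (simp add: associator_bas zero algebra_simps)

text \<open>From \<open>(h,f1,f2) = (h,f2,f1)\<close>: the vector
  \<open>B(h, f1) L f2 - B(f1, f2) R h\<close> is symmetric in \<open>f1\<close> and
  \<open>f2\<close>.\<close>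

lemma h_f_g:
  assumes "h \<noteq> E1" "l \<noteq> E1"
  shows "c h F1 E1 * c E1 F2 l - c F1 F2 E1 * c h E1 l = c h F2 E1 * c E1 F1 l - c F2 F1 E1 * c h E1 l"
  using assoc_sym[of F1 F2 h l] assms
  by (cases h; cases l) (simp_all add: associator_bas zero algebra_simps)

definition classified :: bool where
  "classified \<longleftrightarrow> (\<exists>a \<alpha>. admissible a \<alpha> \<and>
     superalgebra_isomorphic cscale (cmult c) even3 odd3 cscale (Rmult a \<alpha>) even3 odd3)"

text \<open>Instantiated below in the order \<open>a\<close>, \<open>\<alpha>\<close>,
  \<open>x\<close>, \<open>p\<close>, \<open>q\<close>, \<open>r\<close>, \<open>t\<close>: the
  basis of the table is \<open>x e\<close>, \<open>p f1 + q f2\<close>, \<open>r f1 + t f2\<close>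
  in terms of the given one.\<close>

lemma classifiedI:
  assumes "base_change c (coef (table a \<alpha>)) x p q r t" "admissible a \<alpha>"
  shows classified
  unfolding classified_def Rmult_eq_cmult
  using base_change_imp_iso[OF graded graded_table assms(1)] assms(2) by blast

section \<open>Normal forms with an idempotent even generator\<close>

text \<open>Here \<open>R\<close> is scalar and \<open>L\<close> is an idempotent in diagonal form.
  The relations leave at most \<open>f1 f1\<close>, and that only for \<open>L\<close> of rank one;
  a square root then normalises it to \<open>e\<close>.\<close>

lemma classified_diagonal:
  assumes "c E1 E1 E1 = 1"
    and R: "c F1 E1 F1 = \<rho>" "c F1 E1 F2 = 0" "c F2 E1 F1 = 0" "c F2 E1 F2 = \<rho>" and \<rho>: "\<rho> = 0 \<or> \<rho> = 1"
    and L: "c E1 F1 F1 = a" "c E1 F1 F2 = 0" "c E1 F2 F1 = 0" "c E1 F2 F2 = d"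
    and ad: "a = 0 \<and> d = 0 \<or> a = 1 \<and> d = 1 \<or> a = 1 \<and> d = 0"
  shows classified
proof -
  note simps = assms(1) R L base_change_def admissible_def param_family_def coef_def
  \<comment> \<open>For \<open>L = R = I\<close>, \<open>h_f_g\<close> says that each of
    \<open>B(f1, f2)\<close> and \<open>B(f2, f1)\<close> is twice the other.\<close>
  have two: "y = 0 \<and> z = 0" if "2 * y = z" "2 * z = y" for y z :: complex
  proof -
    have "2 * (2 * y) - y = 0" using that(2) unfolding that(1)[symmetric] by simp
    then have "3 * y = 0" by (simp add: algebra_simps)
    with that show ?thesis by simp
  qed
  \<comment> \<open>As \<open>R\<close> is scalar, \<open>g_e_f\<close> becomes
    \<open>B(g, f) = B(g, L f)\<close>, so \<open>B(g, f)\<close> vanishes whenever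
    \<open>L f = 0\<close>.\<close>
  have B: "c F1 F2 E1 = 0 \<and> c F2 F1 E1 = 0 \<and> c F2 F2 E1 = 0 \<and> (a = d \<longrightarrow> c F1 F1 E1 = 0)"
    using \<rho> ad g_e_f[of F1 F1] g_e_f[of F1 F2] g_e_f[of F2 F1] g_e_f[of F2 F2] e_f_g
      h_f_g[of F1 F1] h_f_g[of F1 F2] h_f_g[of F2 F1] h_f_g[of F2 F2]
    by (elim disjE conjE; simp add: assms(1) R L; blast dest: two)
  show ?thesis
  proof (cases "c F1 F1 E1 = 0")
    case True
    consider "\<rho> = 0" "a = 0" "d = 0" | "\<rho> = 0" "a = 1" "d = 1" | "\<rho> = 0" "a = 1" "d = 0"
      | "\<rho> = 1" "a = 0" "d = 0" | "\<rho> = 1" "a = 1" "d = 1" | "\<rho> = 1" "a = 1" "d = 0"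
      using \<rho> ad by blast
    then show ?thesis
    proof cases
      case 1 then show ?thesis by (intro classifiedI[of R19 0 1 1 0 0 1]) (use B True in \<open>simp_all add: simps\<close>)
    next
      case 2 then show ?thesis by (intro classifiedI[of R23 0 1 1 0 0 1]) (use B True in \<open>simp_all add: simps\<close>)
    next
      case 3 then show ?thesis by (intro classifiedI[of R11 0 1 1 0 0 1]) (use B True in \<open>simp_all add: simps\<close>)
    next
      case 4 then show ?thesis by (intro classifiedI[of R22 0 1 1 0 0 1]) (use B True in \<open>simp_all add: simps\<close>)
    next
      case 5 then show ?thesis by (intro classifiedI[of R24 0 1 1 0 0 1]) (use B True in \<open>simp_all add: simps\<close>)
    next
      case 6 then show ?thesis by (intro classifiedI[of R15 0 1 1 0 0 1]) (use B True in \<open>simp_all add: simps\<close>)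
    qed
  next
    case False
    then have ad: "a = 1" "d = 0" using B ad by auto
    define w where "w = 1 / csqrt (c F1 F1 E1)"
    have w: "w * w * c F1 F1 E1 = 1" "w \<noteq> 0"
      using False by (simp_all add: w_def power2_eq_square[symmetric] power_divide)
    from \<rho> show ?thesis
    proof
      assume "\<rho> = 0" then show ?thesis
        by (intro classifiedI[of R12 0 1 w 0 0 1]) (use B ad w in \<open>simp_all add: simps\<close>)
    next
      assume "\<rho> = 1" then show ?thesis
        by (intro classifiedI[of R16 0 1 w 0 0 1]) (use B ad w in \<open>simp_all add: simps\<close>)
    qed
  qed
qed

text \<open>Here \<open>R\<close> is the projection onto \<open>f1\<close> along \<open>f2\<close>.
  The identity \<open>e_e_f\<close> leaves six shapes for \<open>L\<close>, and for each shape the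
  remaining relations kill all odd products except at most one square.\<close>

lemma classified_rank_one_idempotent:
  assumes "c E1 E1 E1 = 1"
    and R: "c F1 E1 F1 = 1" "c F1 E1 F2 = 0" "c F2 E1 F1 = 0" "c F2 E1 F2 = 0"
  shows classified
proof -
  obtain k where k: "k = c E1 F1 F2" by blast
  obtain b where b: "b = c E1 F2 F1" by blast
  have L: "c E1 F1 F1 = 0 \<or> c E1 F1 F1 = 1" "c E1 F2 F2 = 0 \<or> c E1 F2 F2 = 1"
    "k = 0 \<or> b = 0 \<and> c E1 F1 F1 = 0 \<and> c E1 F2 F2 = 0"
    "b = 0 \<or> k = 0 \<and> c E1 F1 F1 = 1 \<and> c E1 F2 F2 = 1"
  proof -
    obtain a where a: "a = c E1 F1 F1" by blast
    obtain d where d: "d = c E1 F2 F2" by blast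
    have e: "a = a * a + b * k" "d = b * k + d * d" "b * (2 - a - d) = 0" "- (a * k) = k * d"
      using e_e_f[of F1 F1] e_e_f[of F2 F2] e_e_f[of F2 F1] e_e_f[of F1 F2]
      by (simp_all add: assms(1) R a d k b algebra_simps)
    then have kad: "k * (a + d) = 0" by algebra
    \<comment> \<open>Two nonzero off-diagonal entries would force the trace of \<open>L\<close> to
      be both 2 and 0.\<close>
    have bk: "b = 0 \<or> k = 0"
    proof (rule ccontr)
      assume "\<not> ?thesis"
      with e(3) kad have "2 - a - d = 0" "a + d = 0" by auto
      then show False by (simp add: diff_diff_eq)
    qed
    then have ad: "a = 0 \<or> a = 1" "d = 0 \<or> d = 1"
      using e(1,2) by auto
    have "k = 0 \<or> a = 0 \<and> d = 0" "b = 0 \<or> a = 1 \<and> d = 1"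
      using e(3) kad ad by auto
    with ad bk show "c E1 F1 F1 = 0 \<or> c E1 F1 F1 = 1" "c E1 F2 F2 = 0 \<or> c E1 F2 F2 = 1"
      "k = 0 \<or> b = 0 \<and> c E1 F1 F1 = 0 \<and> c E1 F2 F2 = 0"
      "b = 0 \<or> k = 0 \<and> c E1 F1 F1 = 1 \<and> c E1 F2 F2 = 1"
      unfolding a d by blast+
  qed
  note rels = g_e_f[of F1 F1] g_e_f[of F1 F2] g_e_f[of F2 F1] g_e_f[of F2 F2] e_f_g
      h_f_g[of F1 F1] h_f_g[of F1 F2] h_f_g[of F2 F1] h_f_g[of F2 F2]
  note simps = assms(1) R k[symmetric] b[symmetric] base_change_def admissible_def param_family_def coef_def
  consider "k \<noteq> 0" "b = 0" "c E1 F1 F1 = 0" "c E1 F2 F2 = 0"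
    | "b \<noteq> 0" "k = 0" "c E1 F1 F1 = 1" "c E1 F2 F2 = 1"
    | "k = 0" "b = 0" "c E1 F1 F1 = 0" "c E1 F2 F2 = 0"
    | "k = 0" "b = 0" "c E1 F1 F1 = 1" "c E1 F2 F2 = 1"
    | "k = 0" "b = 0" "c E1 F1 F1 = 1" "c E1 F2 F2 = 0"
    | "k = 0" "b = 0" "c E1 F1 F1 = 0" "c E1 F2 F2 = 1"
    using L by blast
  then show ?thesis
  proof cases
    case 1
    have "c F1 F1 E1 = 0" "c F1 F2 E1 = 0" "c F2 F1 E1 = 0" "c F2 F2 E1 = 0"
      using rels 1 by (auto simp: simps)
    \<comment> \<open>The new odd vectors are \<open>f1 + k f2\<close> and \<open>k f2\<close>;
      \<open>R\<close> sends the first to \<open>f1\<close>, which is their difference.\<close>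
    with 1 show ?thesis by (intro classifiedI[of R10 0 1 1 k 0 k]) (simp_all add: simps)
  next
    case 2
    have "c F1 F1 E1 = 0" "c F1 F2 E1 = 0" "c F2 F1 E1 = 0" "c F2 F2 E1 = 0"
      using rels 2 by (auto simp: simps)
    \<comment> \<open>The new odd vectors are \<open>b f1\<close> and \<open>f2 - b f1\<close>: this
      keeps the Jordan form of \<open>L\<close>, and \<open>R\<close> sends the second to minus the
      first.\<close>
    with 2 show ?thesis by (intro classifiedI[of R14 0 1 b 0 "-b" 1]) (simp_all add: simps)
  next
    case 3
    have "c F1 F1 E1 = 0" "c F1 F2 E1 = 0" "c F2 F1 E1 = 0" "c F2 F2 E1 = 0"
      using rels 3 by (auto simp: simps)
    with 3 show ?thesis by (intro classifiedI[of R09 0 1 1 0 0 1]) (simp_all add: simps)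
  next
    case 4
    have "c F1 F1 E1 = 0" "c F1 F2 E1 = 0" "c F2 F1 E1 = 0" "c F2 F2 E1 = 0"
      using rels 4 by (auto simp: simps)
    with 4 show ?thesis by (intro classifiedI[of R13 0 1 1 0 0 1]) (simp_all add: simps)
  next
    case 5
    have B: "c F1 F2 E1 = 0" "c F2 F1 E1 = 0" "c F2 F2 E1 = 0"
      using rels 5 by (auto simp: simps)
    show ?thesis
    proof (cases "c F1 F1 E1 = 0")
      case True
      with 5 B show ?thesis by (intro classifiedI[of R17 0 1 1 0 0 1]) (simp_all add: simps)
    next
      case False
      then have "1 / csqrt (c F1 F1 E1) * (1 / csqrt (c F1 F1 E1)) * c F1 F1 E1 = 1"
        by (simp add: power2_eq_square[symmetric] power_divide)
      with False 5 B show ?thesis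
        by (intro classifiedI[of R18 0 1 "1 / csqrt (c F1 F1 E1)" 0 0 1]) (simp_all add: simps)
    qed
  next
    case 6
    have B: "c F1 F1 E1 = 0" "c F1 F2 E1 = 0" "c F2 F1 E1 = 0"
      using rels 6 by (auto simp: simps)
    \<comment> \<open>Now \<open>L\<close> projects onto \<open>f2\<close>, whereas the tables
      \<open>R20\<close> and \<open>R21\<close> have \<open>e1 f1 = f1\<close>, so the odd vectors
      are exchanged.\<close>
    show ?thesis
    proof (cases "c F2 F2 E1 = 0")
      case True
      with 6 B show ?thesis by (intro classifiedI[of R20 0 1 0 1 1 0]) (simp_all add: simps)
    next
      case False
      then have "1 / csqrt (c F2 F2 E1) * (1 / csqrt (c F2 F2 E1)) * c F2 F2 E1 = 1"
        by (simp add: power2_eq_square[symmetric] power_divide)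
      with False 6 B show ?thesis
        by (intro classifiedI[of R21 0 1 0 "1 / csqrt (c F2 F2 E1)" 1 0]) (simp_all add: simps)
    qed
  qed
qed

section \<open>Normal forms with an even generator of square zero\<close>

text \<open>Both operators are multiples of the nilpotent map sending \<open>f1\<close> to
  \<open>f2\<close>. Then \<open>f2 f2 = 0\<close> and one linear relation ties \<open>f1 f2\<close>
  to \<open>f2 f1\<close>. Adding a multiple of \<open>f2\<close> to \<open>f1\<close> does not
  change the operators and serves to clear \<open>f1 f1\<close>.\<close>

lemma classified_nilpotent:
  assumes e: "c E1 E1 E1 = 0"
    and R: "c F1 E1 F1 = 0" "c F1 E1 F2 = \<rho>" "c F2 E1 F1 = 0" "c F2 E1 F2 = 0"
    and L: "c E1 F1 F1 = 0" "c E1 F1 F2 = \<kappa>" "c E1 F2 F1 = 0" "c E1 F2 F2 = 0"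
    and nz: "\<rho> \<noteq> 0 \<or> \<kappa> \<noteq> 0"
  shows classified
proof -
  note simps = e R L base_change_def admissible_def param_family_def coef_def
  obtain \<beta> where \<beta>: "\<beta> = c F2 F1 E1" by blast
  obtain \<gamma> where \<gamma>: "\<gamma> = c F1 F2 E1" by blast
  obtain \<delta> where \<delta>: "\<delta> = c F1 F1 E1" by blast
  note names = \<beta>[symmetric] \<gamma>[symmetric] \<delta>[symmetric]
  have B: "c F2 F2 E1 = 0" "\<rho> * \<beta> = (\<kappa> + \<rho>) * \<gamma>"
    using g_e_f[of F1 F1] g_e_f[of F1 F2] g_e_f[of F2 F1] nz
    by (auto simp: e R L names algebra_simps)
  have sqrt: "csqrt y * csqrt y = y" for y
    by (simp add: power2_eq_square[symmetric])
  show ?thesis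
  \<comment> \<open>The case \<open>L = - R\<close> is the one of \<open>R03\<close>,
    \<open>R27\<close> and \<open>R28\<close>; otherwise the ratio of \<open>L\<close> to
    \<open>R\<close> defines a parameter.\<close>
  proof (cases "\<kappa> + \<rho> = 0")
    case True
    then have \<rho>: "\<rho> = - \<kappa>" and \<kappa>: "\<kappa> \<noteq> 0" using nz by (auto simp: add_eq_0_iff)
    have \<beta>0: "\<beta> = 0" using B(2) \<rho> \<kappa> by auto
    show ?thesis
    proof (cases "\<gamma> = 0")
      case \<gamma>0: True
      show ?thesis
      proof (cases "\<delta> = 0")
        case True
        then show ?thesis
          by (intro classifiedI[of R27 0 1 1 0 0 \<kappa>]) (use B \<kappa> \<rho> \<beta>0 \<gamma>0 in \<open>simp_all add: simps names\<close>)
      next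
        case False
        then show ?thesis
          by (intro classifiedI[of R28 0 \<delta> 1 0 0 "\<delta> * \<kappa>"]) (use B \<kappa> \<rho> \<beta>0 \<gamma>0 in \<open>simp_all add: simps names\<close>)
      qed
    next
      case \<gamma>0: False
      \<comment> \<open>Makes \<open>f1 f2\<close> equal to \<open>2 e\<close> once the new second
        vector is \<open>p \<kappa> f2\<close>; the multiple of \<open>f2\<close> added to
        \<open>p f1\<close> clears \<open>f1 f1\<close>.\<close>
      define p where "p = csqrt (2 / (\<kappa> * \<gamma>))"
      have p: "p * p * \<kappa> * \<gamma> = 2" "p \<noteq> 0"
        using \<kappa> \<gamma>0 sqrt[of "2 / (\<kappa> * \<gamma>)"] by (simp_all add: p_def)
      show ?thesis
        by (intro classifiedI[of R03 0 1 p "- p * \<delta> / \<gamma>" 0 "p * \<kappa>"])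
          (use B \<kappa> \<rho> \<beta>0 \<gamma>0 p in \<open>simp_all add: simps names field_simps\<close>)
    qed
  next
    case False
    \<comment> \<open>Solves \<open>\<kappa> : \<rho> = (1 + \<alpha>) : (1 - \<alpha>)\<close>, the
      ratio prescribed by the tables with parameter.\<close>
    define \<alpha> where "\<alpha> = (\<kappa> - \<rho>) / (\<kappa> + \<rho>)"
    have \<alpha>: "(\<kappa> + \<rho>) * (1 + \<alpha>) = 2 * \<kappa>" "(\<kappa> + \<rho>) * (1 - \<alpha>) = 2 * \<rho>"
      using False by (simp_all add: \<alpha>_def field_simps)
    define \<sigma> where "\<sigma> = (\<kappa> + \<rho>) / 2"
    have \<sigma>: "\<kappa> = \<sigma> * (1 + \<alpha>)" "\<rho> = \<sigma> * (1 - \<alpha>)" "\<sigma> \<noteq> 0"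
      using \<alpha> False by (simp_all add: \<sigma>_def)
    have \<gamma>_eq: "\<gamma> = (1 - \<alpha>) * \<beta> / 2"
    proof -
      have "\<sigma> * (2 * \<gamma>) = \<sigma> * ((1 - \<alpha>) * \<beta>)"
        using B(2) by (simp add: \<sigma>(1,2) algebra_simps)
      then show ?thesis using \<sigma>(3) by (simp add: mult.commute)
    qed
    show ?thesis
    proof (cases "\<beta> = 0")
      case \<beta>0: True
      then have \<gamma>0: "\<gamma> = 0" using \<gamma>_eq by simp
      show ?thesis
      proof (cases "\<delta> = 0")
        case True
        then show ?thesis
          by (intro classifiedI[of R06 \<alpha> 1 1 0 0 \<sigma>]) (use B \<sigma> \<beta>0 \<gamma>0 in \<open>simp_all add: simps names\<close>)
      next
        case False
        then show ?thesis
          by (intro classifiedI[of R07 \<alpha> \<delta> 1 0 0 "\<delta> * \<sigma>"])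
            (use B \<sigma> \<beta>0 \<gamma>0 in \<open>simp_all add: simps names\<close>)
      qed
    next
      case \<beta>0: False
      \<comment> \<open>Since \<open>\<beta> + \<gamma> = (3 - \<alpha>) * \<beta> / 2\<close>, the
        product \<open>f1 f1\<close> can be cleared unless \<open>\<alpha> = 3\<close>. The value
        \<open>-1\<close>, excluded from \<open>R01\<close>, leads to \<open>R08\<close>.\<close>
      consider "\<alpha> = -1" | "\<alpha> = 3" "\<delta> \<noteq> 0" | "\<alpha> \<noteq> -1" "\<alpha> = 3 \<longrightarrow> \<delta> = 0" by blast
      then show ?thesis
      proof cases
        case 1
        define p where "p = csqrt (1 / (\<sigma> * \<beta>))"
        have p: "p * p * \<sigma> * \<beta> = 1" "p \<noteq> 0"
          using \<sigma> \<beta>0 sqrt[of "1 / (\<sigma> * \<beta>)"] by (simp_all add: p_def)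
        show ?thesis
          by (intro classifiedI[of R08 0 1 p "- p * \<delta> / (2 * \<beta>)" 0 "p * \<sigma>"])
            (use B \<sigma> \<beta>0 \<gamma>_eq p 1 in \<open>simp_all add: simps names field_simps\<close>)
      next
        case 2
        \<comment> \<open>The new even vector is the square of \<open>p f1\<close>; this choice of
          \<open>p\<close> gives \<open>f2 f1 = - e1\<close>.\<close>
        define p where "p = csqrt (-1 / (\<sigma> * \<beta>))"
        have p: "p * p * \<sigma> * \<beta> = -1" "p \<noteq> 0"
          using \<sigma> \<beta>0 sqrt[of "-1 / (\<sigma> * \<beta>)"] by (simp_all add: p_def)
        show ?thesis
        proof (rule classifiedI)
          have "p * (p * p * p * \<delta> * \<sigma>) * \<beta> = p * p * \<sigma> * \<beta> * (p * p * \<delta>)"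
            by (simp add: algebra_simps)
          then have "p * (p * p * p * \<delta> * \<sigma>) * \<beta> = - (p * p * \<delta>)" using p by simp
          then show "base_change c (coef (table R02 0)) (p * p * \<delta>) p 0 0 (p * p * p * \<delta> * \<sigma>)"
            using B \<sigma> \<gamma>_eq p 2 by (simp add: simps names mult_ac)
        qed (simp add: simps)
      next
        case 3
        define p where "p = csqrt (- 4 / ((\<alpha> + 1) * \<sigma> * \<beta>))"
        have "\<alpha> + 1 \<noteq> 0" using 3 by (simp add: add_eq_0_iff2)
        then have p: "p * p * \<sigma> * \<beta> = - 4 / (\<alpha> + 1)" "p \<noteq> 0"
          using \<sigma> \<beta>0 sqrt[of "- 4 / ((\<alpha> + 1) * \<sigma> * \<beta>)"] by (simp_all add: p_def)
        \<comment> \<open>Solves the linear equation that clears \<open>f1 f1\<close>. For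
          \<open>\<alpha> = 3\<close> the coefficient of \<open>q\<close> is zero, but then
          \<open>\<delta> = 0\<close> and the value 0 serves.\<close>
        define q where "q = (if \<alpha> = 3 then 0 else - 2 * p * \<delta> / ((3 - \<alpha>) * \<beta>))"
        have q: "p * \<delta> + q * (3 - \<alpha>) * \<beta> / 2 = 0"
          using 3 \<beta>0 by (auto simp: q_def)
        show ?thesis
        proof (rule classifiedI)
          have "p * p * \<delta> + p * q * (\<gamma> + \<beta>) = p * (p * \<delta> + q * (3 - \<alpha>) * \<beta> / 2)"
            by (simp add: \<gamma>_eq field_simps)
          then have "p * p * \<delta> + p * q * (\<gamma> + \<beta>) = 0" using q by simp
          moreover have "p * (p * \<sigma>) * \<beta> = - (4 / (\<alpha> + 1))" using p by (simp add: mult.assoc)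
          moreover have "p * (p * \<sigma>) * \<gamma> = (1 - \<alpha>) / 2 * (p * p * \<sigma> * \<beta>)"
            by (simp add: \<gamma>_eq)
          then have "p * (p * \<sigma>) * \<gamma> = 2 * (\<alpha> - 1) / (\<alpha> + 1)"
            unfolding p(1)
          proof -
            assume "p * (p * \<sigma>) * \<gamma> = (1 - \<alpha>) / 2 * (- 4 / (\<alpha> + 1))"
            also have "\<dots> = ((1 - \<alpha>) / 2 * - 4) / (\<alpha> + 1)" by simp
            also have "(1 - \<alpha>) / 2 * - 4 = 2 * (\<alpha> - 1)" by (simp add: field_simps)
            finally show ?thesis .
          qed
          ultimately show "base_change c (coef (table R01 \<alpha>)) 1 p q 0 (p * \<sigma>)"
            using B(1) \<sigma> p(2) by (simp add: simps names mult_ac)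
        qed (use 3 in \<open>simp add: simps\<close>)
      qed
    qed
  qed
qed

text \<open>The identity \<open>e_e_f\<close> now says \<open>R L - L R = L L\<close>. With
  \<open>R f1 = f2\<close> and \<open>R f2 = 0\<close> it forces \<open>L\<close> to be a multiple
  of \<open>R\<close>, which is the situation of \<open>classified_nilpotent\<close>.\<close>

lemma classified_right_nilpotent:
  assumes e: "c E1 E1 E1 = 0"
    and R: "c F1 E1 F1 = 0" "c F1 E1 F2 = 1" "c F2 E1 F1 = 0" "c F2 E1 F2 = 0"
  shows classified
proof -
  obtain a b k d where abkd: "a = c E1 F1 F1" "b = c E1 F2 F1" "k = c E1 F1 F2" "d = c E1 F2 F2" by blast
  have eqs: "- (a * a) - k * b = b" "- (b * a) = d * b" "- (b * k) - d * d + b = 0"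
    using e_e_f[of F1 F1] e_e_f[of F2 F1] e_e_f[of F2 F2] by (simp_all add: e R abkd)
  have "b = 0"
  proof (rule ccontr)
    assume b: "b \<noteq> 0"
    have "b * (a + d) = 0" using eqs(2) by algebra
    with b have "d = - a" by (simp add: add_eq_0_iff)
    with eqs(3) have "(- (a * a) - k * b) + b = 0" by (simp add: algebra_simps)
    then have "2 * b = 0" unfolding eqs(1) by simp
    with b show False by simp
  qed
  with eqs(1,3) have "a = 0" "d = 0" by auto
  with \<open>b = 0\<close> show ?thesis
    using e R by (intro classified_nilpotent[of 1 k]) (simp_all add: abkd)
qed

text \<open>With both operators zero the algebra is just a bilinear form on the odd plane, to be
  normalised up to congruence and scaling. The first basis vector is isotropic.\<close>

lemma classified_bilinear:
  assumes e: "c E1 E1 E1 = 0"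
    and R: "c F1 E1 F1 = 0" "c F1 E1 F2 = 0" "c F2 E1 F1 = 0" "c F2 E1 F2 = 0"
    and L: "c E1 F1 F1 = 0" "c E1 F1 F2 = 0" "c E1 F2 F1 = 0" "c E1 F2 F2 = 0"
    and isotropic: "c F1 F1 E1 = 0"
    and nz: "c F1 F2 E1 \<noteq> 0 \<or> c F2 F1 E1 \<noteq> 0 \<or> c F2 F2 E1 \<noteq> 0"
  shows classified
proof -
  note simps = e R L isotropic base_change_def admissible_def param_family_def coef_def
  obtain \<beta> where \<beta>: "\<beta> = c F2 F1 E1" by blast
  obtain \<gamma> where \<gamma>: "\<gamma> = c F1 F2 E1" by blast
  obtain \<delta> where \<delta>: "\<delta> = c F2 F2 E1" by blast
  note names = \<beta>[symmetric] \<gamma>[symmetric] \<delta>[symmetric]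
  show ?thesis
  \<comment> \<open>In the first case the symmetric part has rank at most one; in the second
    \<open>\<mu> f1 + f2\<close> is another isotropic vector.\<close>
  proof (cases "\<beta> + \<gamma> = 0")
    case True
    then have \<beta>_eq: "\<beta> = - \<gamma>" by (simp add: add_eq_0_iff2)
    consider "\<gamma> = 0" "\<delta> \<noteq> 0" | "\<gamma> \<noteq> 0" "\<delta> = 0" | "\<gamma> \<noteq> 0" "\<delta> \<noteq> 0"
      using nz \<beta>_eq names by auto
    then show ?thesis
    proof cases
      case 1 then show ?thesis
        by (intro classifiedI[of R26 0 \<delta> 0 1 1 0]) (use \<beta>_eq in \<open>simp_all add: simps names\<close>)
    next
      case 2 then show ?thesis
        by (intro classifiedI[of R04 0 \<gamma> 1 0 0 1]) (use \<beta>_eq in \<open>simp_all add: simps names\<close>)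
    next
      case 3 then show ?thesis
        by (intro classifiedI[of R05 0 "- \<delta>" "- \<delta> / \<gamma>" 0 0 1]) (use \<beta>_eq in \<open>simp_all add: simps names\<close>)
    qed
  next
    case False
    define \<mu> where "\<mu> = - \<delta> / (\<beta> + \<gamma>)"
    have \<mu>: "\<delta> + \<mu> * (\<beta> + \<gamma>) = 0" using False by (simp add: \<mu>_def)
    show ?thesis
    proof (cases "\<beta> = \<gamma>")
      case True
      then have "\<gamma> \<noteq> 0" using False by auto
      with True show ?thesis
        by (intro classifiedI[of R25 0 \<gamma> 1 0 \<mu> 1]) (use \<mu> in \<open>simp_all add: simps names algebra_simps\<close>)
    next
      case neq: False
      \<comment> \<open>The ratio of the symmetric to the alternating part of the form.\<close>
      define \<alpha> where "\<alpha> = (\<gamma> + \<beta>) / (\<gamma> - \<beta>)"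
      have \<alpha>: "\<gamma> = (\<gamma> - \<beta>) / 2 * (\<alpha> + 1)" "\<beta> = (\<gamma> - \<beta>) / 2 * (\<alpha> - 1)"
        using neq by (simp_all add: \<alpha>_def field_simps)
      have "base_change c (coef (table R04 \<alpha>)) ((\<gamma> - \<beta>) / 2) 1 0 \<mu> 1"
        using neq \<mu> \<alpha> by (simp add: simps names algebra_simps)
      then show ?thesis
        by (rule classifiedI) (simp add: simps)
    qed
  qed
qed

end

section \<open>Choosing a basis\<close>

locale superalgebra_1_2 = vector_space s
  for s :: "complex \<Rightarrow> 'a::ab_group_add \<Rightarrow> 'a" +
  fixes m :: "'a \<Rightarrow> 'a \<Rightarrow> 'a" and A0 A1 :: "'a set"
  assumes type: "superalgebra_type s m A0 A1 1 2"
    and right_alt: "right_alternative m A0 A1"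
begin

lemma superalgebra: "superalgebra s m A0 A1"
  using type by (simp add: superalgebra_type_def)

lemma dims: "dim A0 = 1" "dim A1 = 2"
  using type by (simp_all add: superalgebra_type_def)

lemma subspaces: "subspace A0" "subspace A1"
  using superalgebra by (simp_all add: superalgebra_def)

lemma closed:
  "x \<in> A0 \<Longrightarrow> y \<in> A0 \<Longrightarrow> m x y \<in> A0" "x \<in> A0 \<Longrightarrow> y \<in> A1 \<Longrightarrow> m x y \<in> A1"
  "x \<in> A1 \<Longrightarrow> y \<in> A0 \<Longrightarrow> m x y \<in> A1" "x \<in> A1 \<Longrightarrow> y \<in> A1 \<Longrightarrow> m x y \<in> A0"
  using superalgebra by (simp_all add: superalgebra_def)

lemma bilinear:
  "m (x + y) z = m x z + m y z" "m x (y + z) = m x y + m x z"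
  "m (x - y) z = m x z - m y z" "m x (y - z) = m x y - m x z"
  "m (s a x) y = s a (m x y)" "m x (s a y) = s a (m x y)" "m 0 x = 0" "m x 0 = 0"
proof -
  have linl: "Vector_Spaces.linear s s (\<lambda>x. m x z)" and linr: "Vector_Spaces.linear s s (m z)" for z
    using superalgebra by (auto simp: superalgebra_def)
  interpret ml: Vector_Spaces.linear s s "\<lambda>x. m x z" for z by (rule linl)
  interpret mr: Vector_Spaces.linear s s "m z" for z by (rule linr)
  show "m (x + y) z = m x z + m y z" "m x (y + z) = m x y + m x z"
    "m (x - y) z = m x z - m y z" "m x (y - z) = m x y - m x z"
    "m (s a x) y = s a (m x y)" "m x (s a y) = s a (m x y)" "m 0 x = 0" "m x 0 = 0"
    by (simp_all add: ml.add mr.add ml.diff mr.diff ml.scale mr.scale ml.zero mr.zero)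
qed

text \<open>The type carries only a group structure; the absence of 2-torsion comes from the complex
  scalars.\<close>

lemma eq_neg_imp_zero: "x = 0" if "x = - x" for x :: 'a
proof -
  have "s 2 x = x + x" using scale_left_distrib[of 1 1 x] by simp
  also have "\<dots> = 0" using that by (metis add.right_inverse)
  finally show ?thesis by simp
qed

text \<open>On a line \<open>g g = k g\<close>, and dividing \<open>g\<close> by a nonzero
  \<open>k\<close> gives an idempotent.\<close>

lemma even_generator:
  obtains e where "e \<noteq> 0" "A0 = range (\<lambda>a. s a e)" "m e e = 0 \<or> m e e = e"
proof -
  obtain B where B: "B \<subseteq> A0" "independent B" "A0 \<subseteq> span B" "card B = dim A0"
    by (rule basis_exists)
  then obtain g where g: "B = {g}" by (auto simp: dims card_1_singleton_iff)
  have "span B \<subseteq> A0" using B(1) subspaces(1) by (rule span_minimal)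
  with B g have A0: "A0 = range (\<lambda>a. s a g)" by (auto simp: span_singleton)
  have "g \<noteq> 0" using B g by auto
  have "m g g \<in> A0" using B g by (simp add: closed)
  then obtain k where k: "m g g = s k g" using A0 by auto
  show ?thesis
  proof (cases "k = 0")
    case True then show ?thesis using that[of g] A0 k \<open>g \<noteq> 0\<close> by simp
  next
    case False
    have "A0 = range (\<lambda>a. s a (s (1 / k) g))"
    proof -
      have "s a g \<in> range (\<lambda>a. s a (s (1 / k) g))" for a
        using False by (intro image_eqI[of _ _ "a * k"]) simp_all
      then show ?thesis unfolding A0 by auto
    qed
    moreover have "m (s (1 / k) g) (s (1 / k) g) = s (1 / k) g"
      using False k by (simp add: bilinear)
    ultimately show ?thesis using that[of "s (1 / k) g"] \<open>g \<noteq> 0\<close> False by simp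
  qed
qed

definition odd_basis :: "'a \<Rightarrow> 'a \<Rightarrow> bool" where
  "odd_basis f g \<longleftrightarrow> f \<in> A1 \<and> g \<in> A1 \<and> (\<forall>a b. s a f + s b g = 0 \<longrightarrow> a = 0 \<and> b = 0)"

text \<open>A vector of the odd plane outside the span of \<open>f\<close> and \<open>g\<close>
  would give three independent vectors in the span of a two-element basis.\<close>

lemma A1_eq:
  assumes "odd_basis f g"
  shows "A1 = {s a f + s b g | a b. True}"
proof -
  have fg: "f \<in> A1" "g \<in> A1" and ind: "\<And>a b. s a f + s b g = 0 \<Longrightarrow> a = 0 \<and> b = 0"
    using assms by (auto simp: odd_basis_def)
  have "f \<noteq> g" using ind[of 1 "-1"] by auto
  have gf: "independent {f, g}"
  proof -
    have "g \<noteq> 0" using ind[of 0 1] by auto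
    moreover have "f \<noteq> s k g" for k using ind[of 1 "- k"] by auto
    ultimately show ?thesis
      by (auto simp: independent_insert span_singleton \<open>f \<noteq> g\<close>)
  qed
  obtain B where "B \<subseteq> A1" "independent B" "A1 \<subseteq> span B" "card B = dim A1"
    by (rule basis_exists)
  then have B: "A1 \<subseteq> span B" "card B = 2" by (simp_all add: dims)
  have "finite B" using B(2) by (simp add: card_ge_0_finite)
  have "x \<in> span {f, g}" if "x \<in> A1" for x
  proof (rule ccontr)
    assume x: "x \<notin> span {f, g}"
    then have "independent (insert x {f, g})" using gf by (rule independent_insertI)
    moreover have "insert x {f, g} \<subseteq> span B" using B fg that by auto
    ultimately have "card (insert x {f, g}) \<le> card B"
      using independent_span_bound[OF \<open>finite B\<close>] by blast
    moreover have "x \<notin> {f, g}" using x span_base by blast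
    ultimately show False using B \<open>f \<noteq> g\<close> by simp
  qed
  moreover have "span {f, g} \<subseteq> A1" using fg subspaces(2) by (intro span_minimal) auto
  ultimately have "A1 = span {f, g}" by blast
  also have "\<dots> = {s a f + s b g | a b. True}"
    by (simp add: set_eq_iff span_insert span_singleton image_iff diff_eq_eq add.commute)
  finally show ?thesis .
qed

lemma odd_basis_exists: "\<exists>f g. odd_basis f g"
proof -
  obtain B where B: "B \<subseteq> A1" "independent B" "A1 \<subseteq> span B" "card B = dim A1"
    by (rule basis_exists)
  then obtain f g where fg: "B = {f, g}" "f \<noteq> g" by (auto simp: dims card_2_iff)
  have g: "g \<noteq> 0" and f: "f \<notin> range (\<lambda>k. s k g)"
    using B(2) fg by (auto simp: independent_insert span_singleton)
  have "a = 0 \<and> b = 0" if ab: "s a f + s b g = 0" for a b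
  proof -
    have "a = 0"
    proof (rule ccontr)
      assume "a \<noteq> 0"
      then have "f = s (1 / a) (s a f)" by simp
      also have "s a f = - s b g" using ab by (simp add: eq_neg_iff_add_eq_0)
      also have "s (1 / a) (- s b g) = s (- b / a) g" by simp
      finally show False using f by blast
    qed
    with ab g show ?thesis by simp
  qed
  then show ?thesis using B fg by (auto simp: odd_basis_def)
qed

text \<open>Otherwise there are a nonzero image vector \<open>T x\<close> and a nonzero kernel
  vector \<open>y - T y\<close>; as eigenvectors for 1 and 0 they are independent.\<close>

lemma odd_basis_idempotent:
  assumes A: "\<And>x. x \<in> A1 \<Longrightarrow> T x \<in> A1" and add: "\<And>x y. T (x - y) = T x - T y"
    and lin: "\<And>x y a b. T (s a x + s b y) = s a (T x) + s b (T y)"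
    and idem: "\<And>x. x \<in> A1 \<Longrightarrow> T (T x) = T x"
  shows "(\<forall>x\<in>A1. T x = 0) \<or> (\<forall>x\<in>A1. T x = x) \<or> (\<exists>f g. odd_basis f g \<and> T f = f \<and> T g = 0)"
proof (cases "(\<forall>x\<in>A1. T x = 0) \<or> (\<forall>x\<in>A1. T x = x)")
  case False
  then obtain x y where xy: "x \<in> A1" "T x \<noteq> 0" "y \<in> A1" "T y \<noteq> y" by blast
  have "odd_basis (T x) (y - T y)"
    unfolding odd_basis_def
  proof (intro conjI allI impI)
    show "T x \<in> A1" "y - T y \<in> A1" using xy A subspaces(2) by (auto simp: subspace_diff)
    fix a b assume 0: "s a (T x) + s b (y - T y) = 0"
    then have "T (s a (T x) + s b (y - T y)) = T 0" by simp
    moreover have "T 0 = 0" using lin[of 0 0 0 0] by simp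
    ultimately have "s a (T x) = 0" using xy by (simp add: lin add idem)
    with xy have "a = 0" by simp
    with 0 xy show "a = 0" "b = 0" by auto
  qed
  moreover have "T (T x) = T x" "T (y - T y) = 0" using xy by (simp_all add: add idem)
  ultimately show ?thesis by blast
qed blast

text \<open>If \<open>T x \<noteq> 0\<close>, then \<open>x\<close> and \<open>T x\<close> are
  independent, as applying \<open>T\<close> to a relation shows.\<close>

lemma odd_basis_nilpotent:
  assumes A: "\<And>x. x \<in> A1 \<Longrightarrow> T x \<in> A1"
    and lin: "\<And>x y a b. T (s a x + s b y) = s a (T x) + s b (T y)"
    and nil: "\<And>x. x \<in> A1 \<Longrightarrow> T (T x) = 0"
  shows "(\<forall>x\<in>A1. T x = 0) \<or> (\<exists>f g. odd_basis f g \<and> T f = g \<and> T g = 0)"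
proof (cases "\<forall>x\<in>A1. T x = 0")
  case False
  then obtain x where x: "x \<in> A1" "T x \<noteq> 0" by blast
  have "odd_basis x (T x)"
    unfolding odd_basis_def
  proof (intro conjI allI impI)
    show "x \<in> A1" "T x \<in> A1" using x A by auto
    fix a b assume 0: "s a x + s b (T x) = 0"
    then have "T (s a x + s b (T x)) = T 0" by simp
    moreover have "T 0 = 0" using lin[of 0 0 0 0] by simp
    ultimately have "s a (T x) = 0" using x by (simp add: lin nil)
    with x have "a = 0" by simp
    with 0 x show "a = 0" "b = 0" by auto
  qed
  then show ?thesis using x nil by blast
qed blast

text \<open>A quadratic form on a complex plane has a nontrivial zero. If \<open>g\<close> is not
  one itself, some \<open>f + t g\<close> is.\<close>

lemma odd_isotropic:
  assumes e: "e \<noteq> 0" "A0 = range (\<lambda>a. s a e)"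
  shows "\<exists>f g. odd_basis f g \<and> m f f = 0"
proof -
  obtain f g where fg: "odd_basis f g" using odd_basis_exists by blast
  then have "f \<in> A1" "g \<in> A1" by (auto simp: odd_basis_def)
  then have "m f f \<in> A0" "m f g \<in> A0" "m g f \<in> A0" "m g g \<in> A0" by (auto simp: closed)
  then obtain a b c d where abcd: "m f f = s a e" "m f g = s b e" "m g f = s c e" "m g g = s d e"
    unfolding e(2) by blast
  show ?thesis
  proof (cases "d = 0")
    case True
    moreover have "odd_basis g f" using fg unfolding odd_basis_def by (metis add.commute)
    ultimately show ?thesis using abcd(4) by auto
  next
    case False
    \<comment> \<open>A root of \<open>d t t + (b + c) t + a\<close>, the coefficient of
      \<open>e\<close> in the square of \<open>f + t g\<close>.\<close>
    define t where "t = (csqrt ((b + c)^2 - 4 * a * d) - (b + c)) / (2 * d)"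
    have "(2 * d * t + (b + c))^2 = (b + c)^2 - 4 * a * d"
      using False by (simp add: t_def)
    then have "4 * d * (a + t * (b + c) + t * t * d) = 0"
      by (simp add: power2_eq_square algebra_simps)
    with False have t: "a + t * (b + c) + t * t * d = 0" by simp
    have "m (f + s t g) (f + s t g) = s (a + t * (b + c) + t * t * d) e"
      by (simp add: bilinear abcd scale_left_distrib algebra_simps)
    then have "m (f + s t g) (f + s t g) = 0" using t by simp
    moreover have "odd_basis (f + s t g) g"
      unfolding odd_basis_def
    proof (intro conjI allI impI)
      show "f + s t g \<in> A1" "g \<in> A1"
        using \<open>f \<in> A1\<close> \<open>g \<in> A1\<close> subspaces(2) by (auto simp: subspace_def)
      fix u v assume "s u (f + s t g) + s v g = 0"
      then have "s u f + s (u * t + v) g = 0" by (simp add: algebra_simps)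
      then have "u = 0 \<and> u * t + v = 0" using fg by (simp add: odd_basis_def)
      then show "u = 0" "v = 0" by auto
    qed
    ultimately show ?thesis by blast
  qed
qed

text \<open>Passes from the abstract algebra to coordinates. Uniqueness of coordinates, the last
  conclusion, lets single constants be read off from known products.\<close>

lemma structure_constants:
  assumes e: "e \<noteq> 0" "A0 = range (\<lambda>a. s a e)" and fg: "odd_basis f g"
  obtains c where "right_alternative_constants c"
    "superalgebra_isomorphic s m A0 A1 cscale (cmult c) even3 odd3"
    "\<And>i j. m (case_b3 e f g i) (case_b3 e f g j) = comb s (case_b3 e f g) (c i j)"
    "\<And>u w. comb s (case_b3 e f g) u = comb s (case_b3 e f g) w \<Longrightarrow> u = w"
proof -
  let ?v = "case_b3 e f g"
  have zero: "u = 0" if "comb s ?v u = 0" for u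
  proof -
    have 0: "s (u E1) e = s (- u F1) f + s (- u F2) g"
      using that by (simp add: comb_def algebra_simps eq_neg_iff_add_eq_0)
    then have "s (u E1) e \<in> A1" unfolding A1_eq[OF fg] by blast
    moreover have "s (u E1) e \<in> A0" unfolding e(2) by blast
    moreover have "A0 \<inter> A1 = {0}" using superalgebra by (simp add: superalgebra_def)
    ultimately have "s (u E1) e = 0" by blast
    moreover from this 0 have "- u F1 = 0 \<and> - u F2 = 0"
      using fg unfolding odd_basis_def by metis
    ultimately show ?thesis using e(1) by (simp add: fun_eq_b3)
  qed
  have fr: "frame s A0 A1 ?v"
    unfolding frame_def using zero A1_eq[OF fg] e(2) by auto
  have inj: "u = w" if "comb s ?v u = comb s ?v w" for u w
  proof -
    have "comb s ?v (u - w) = 0" using that by (simp add: comb_def algebra_simps)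
    then show ?thesis using zero by fastforce
  qed
  have v: "?v E1 \<in> A0" "?v F1 \<in> A1" "?v F2 \<in> A1"
    using fg unfolding e(2) odd_basis_def by (auto intro: range_eqI[of _ _ 1])
  have even: "\<exists>u. x = comb s ?v u \<and> u \<in> even3" if x: "x \<in> A0" for x
  proof -
    obtain a where "x = s a e" using x e(2) by blast
    then show ?thesis by (intro exI[of _ "case_b3 a 0 0"]) (simp add: comb_def even3_def)
  qed
  have odd: "\<exists>u. x = comb s ?v u \<and> u \<in> odd3" if x: "x \<in> A1" for x
  proof -
    obtain a b where "x = s a f + s b g" using x A1_eq[OF fg] by blast
    then show ?thesis by (intro exI[of _ "case_b3 0 a b"]) (simp add: comb_def odd3_def)
  qed
  \<comment> \<open>A product is even exactly when its factors have the same parity.\<close>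
  have "\<exists>u. m (?v i) (?v j) = comb s ?v u \<and> (if i = E1 \<longleftrightarrow> j = E1 then u \<in> even3 else u \<in> odd3)" for i j
    using v closed by (cases i; cases j) (auto intro!: even odd)
  then obtain c where c: "\<And>i j. m (?v i) (?v j) = comb s ?v (c i j) \<and>
      (if i = E1 \<longleftrightarrow> j = E1 then c i j \<in> even3 else c i j \<in> odd3)"
    by metis
  have iso: "superalgebra_iso cscale (cmult c) even3 odd3 s m A0 A1 (comb s ?v)"
    using superalgebra fr c by (intro comb_iso) auto
  show ?thesis
  proof
    show "right_alternative_constants c"
    proof
      show "graded c" using c unfolding graded_def by (metis b3.distinct(1,3) insertE singletonD)
      show "right_alternative (cmult c) even3 odd3"
        using iso right_alt by (rule right_alternative_iso)
    qed
    show "superalgebra_isomorphic s m A0 A1 cscale (cmult c) even3 odd3"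
      using iso superalgebra_isomorphic_sym unfolding superalgebra_isomorphic_def by blast
  qed (use c inj in auto)
qed

end

section \<open>Invariants\<close>

text \<open>With \<open>L\<close> and \<open>R\<close> the left and right multiplications by the even generator on the odd
  part and \<open>e e = \<epsilon> e\<close>, this says \<open>a L + b R + k \<epsilon> I = 0\<close>; the factor \<open>\<epsilon>\<close> makes it independent of
  the scaling of the generator.\<close>
definition lin_rel :: "(b3 \<Rightarrow> b3 \<Rightarrow> b3 \<Rightarrow> complex) \<Rightarrow> complex \<Rightarrow> complex \<Rightarrow> complex \<Rightarrow> bool" where
  "lin_rel c a b k \<longleftrightarrow>
     a * c E1 F1 F1 + b * c F1 E1 F1 + k * c E1 E1 E1 = 0 \<and> a * c E1 F1 F2 + b * c F1 E1 F2 = 0 \<and>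
     a * c E1 F2 F1 + b * c F2 E1 F1 = 0 \<and> a * c E1 F2 F2 + b * c F2 E1 F2 + k * c E1 E1 E1 = 0"

definition trace_left :: "(b3 \<Rightarrow> b3 \<Rightarrow> b3 \<Rightarrow> complex) \<Rightarrow> complex" where
  "trace_left c = c E1 F1 F1 + c E1 F2 F2"

definition sym_zero :: "(b3 \<Rightarrow> b3 \<Rightarrow> b3 \<Rightarrow> complex) \<Rightarrow> bool" where
  "sym_zero c \<longleftrightarrow> c F1 F1 E1 = 0 \<and> c F1 F2 E1 + c F2 F1 E1 = 0 \<and> c F2 F2 E1 = 0"

definition alt_part :: "(b3 \<Rightarrow> b3 \<Rightarrow> b3 \<Rightarrow> complex) \<Rightarrow> complex" where
  "alt_part c = c F1 F2 E1 - c F2 F1 E1"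

text \<open>The discriminant of the quadratic form \<open>f f\<close> on the odd plane.\<close>

definition discr :: "(b3 \<Rightarrow> b3 \<Rightarrow> b3 \<Rightarrow> complex) \<Rightarrow> complex" where
  "discr c = (c F1 F2 E1 + c F2 F1 E1)\<^sup>2 - 4 * c F1 F1 E1 * c F2 F2 E1"

text \<open>Up to conjugation \<open>\<epsilon>\<close>, \<open>L\<close> and \<open>R\<close> scale
  by \<open>x\<close>, while \<open>alt_part\<close> scales by the odd determinant over
  \<open>x\<close> and \<open>discr\<close> by its square. So vanishing is invariant, and so are the
  ratios of \<open>trace_left\<close> to \<open>\<epsilon>\<close> and of \<open>discr\<close> to
  the square of \<open>alt_part\<close>, stated here without division.\<close>

lemma base_change_invariants:
  assumes "base_change c d x p q r t"
  shows "c E1 E1 E1 = 0 \<longleftrightarrow> d E1 E1 E1 = 0"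
    and "lin_rel c a b k \<Longrightarrow> lin_rel d a b k"
    and "trace_left c * d E1 E1 E1 = trace_left d * c E1 E1 E1"
    and "sym_zero c \<Longrightarrow> sym_zero d"
    and "alt_part c = 0 \<longleftrightarrow> alt_part d = 0"
    and "discr c = 0 \<longleftrightarrow> discr d = 0"
    and "discr c * (alt_part d)\<^sup>2 = discr d * (alt_part c)\<^sup>2"
proof -
  have x: "x \<noteq> 0" and D: "p * t - q * r \<noteq> 0" and e: "d E1 E1 E1 = x * c E1 E1 E1"
    using assms by (simp_all add: base_change_def)
  have L: "x * (p * c E1 F1 F1 + q * c E1 F2 F1) = p * d E1 F1 F1 + r * d E1 F1 F2"
    "x * (p * c E1 F1 F2 + q * c E1 F2 F2) = q * d E1 F1 F1 + t * d E1 F1 F2"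
    "x * (r * c E1 F1 F1 + t * c E1 F2 F1) = p * d E1 F2 F1 + r * d E1 F2 F2"
    "x * (r * c E1 F1 F2 + t * c E1 F2 F2) = q * d E1 F2 F1 + t * d E1 F2 F2"
    using assms by (simp_all add: base_change_def)
  have R: "x * (p * c F1 E1 F1 + q * c F2 E1 F1) = p * d F1 E1 F1 + r * d F1 E1 F2"
    "x * (p * c F1 E1 F2 + q * c F2 E1 F2) = q * d F1 E1 F1 + t * d F1 E1 F2"
    "x * (r * c F1 E1 F1 + t * c F2 E1 F1) = p * d F2 E1 F1 + r * d F2 E1 F2"
    "x * (r * c F1 E1 F2 + t * c F2 E1 F2) = q * d F2 E1 F1 + t * d F2 E1 F2"
    using assms by (simp_all add: base_change_def)
  have B: "x * d F1 F1 E1 = p * p * c F1 F1 E1 + p * q * (c F1 F2 E1 + c F2 F1 E1) + q * q * c F2 F2 E1"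
    "x * d F1 F2 E1 = p * r * c F1 F1 E1 + p * t * c F1 F2 E1 + q * r * c F2 F1 E1 + q * t * c F2 F2 E1"
    "x * d F2 F1 E1 = p * r * c F1 F1 E1 + r * q * c F1 F2 E1 + t * p * c F2 F1 E1 + q * t * c F2 F2 E1"
    "x * d F2 F2 E1 = r * r * c F1 F1 E1 + r * t * (c F1 F2 E1 + c F2 F1 E1) + t * t * c F2 F2 E1"
    using assms by (simp_all add: base_change_def)
  \<comment> \<open>The transpose of the odd block is invertible.\<close>
  have kernel: "y = 0 \<and> z = 0" if "p * y + r * z = 0" "q * y + t * z = 0" for y z
  proof -
    have "(p * t - q * r) * y = t * (p * y + r * z) - r * (q * y + t * z)"
      "(p * t - q * r) * z = p * (q * y + t * z) - q * (p * y + r * z)"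
      by (simp_all add: algebra_simps)
    then show ?thesis using that D by simp
  qed
  show "c E1 E1 E1 = 0 \<longleftrightarrow> d E1 E1 E1 = 0"
    using x e by simp
  show "lin_rel d a b k" if "lin_rel c a b k"
  proof -
    \<comment> \<open>\<open>M\<close> and \<open>N\<close> are the matrices of
      \<open>a L + b R + k \<epsilon> I\<close> in the two bases; with \<open>P\<close> the odd
      block, \<open>N P = x P M\<close>.\<close>
    define M where "M i j = a * c E1 i j + b * c i E1 j + (if i = j then k * c E1 E1 E1 else 0)" for i j
    define N where "N i j = a * d E1 i j + b * d i E1 j + (if i = j then k * d E1 E1 E1 else 0)" for i j
    have M0: "M F1 F1 = 0" "M F1 F2 = 0" "M F2 F1 = 0" "M F2 F2 = 0"
      using that by (simp_all add: lin_rel_def M_def)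
    have "p * N F1 F1 + r * N F1 F2 = x * (p * M F1 F1 + q * M F2 F1)"
      "q * N F1 F1 + t * N F1 F2 = x * (p * M F1 F2 + q * M F2 F2)"
      "p * N F2 F1 + r * N F2 F2 = x * (r * M F1 F1 + t * M F2 F1)"
      "q * N F2 F1 + t * N F2 F2 = x * (r * M F1 F2 + t * M F2 F2)"
      using L R by (simp_all add: M_def N_def e) algebra+
    then have "N F1 F1 = 0 \<and> N F1 F2 = 0" "N F2 F1 = 0 \<and> N F2 F2 = 0"
      by (intro kernel; simp add: M0)+
    then show ?thesis by (simp add: lin_rel_def N_def)
  qed
  have "(p * t - q * r) * (x * trace_left c) = (p * t - q * r) * trace_left d"
    unfolding trace_left_def using L by algebra
  then have "trace_left d = x * trace_left c" using D by simp
  then show "trace_left c * d E1 E1 E1 = trace_left d * c E1 E1 E1"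
    by (simp add: e)
  show "sym_zero d" if "sym_zero c"
  proof -
    have c0: "c F1 F1 E1 = 0" "c F2 F1 E1 = - c F1 F2 E1" "c F2 F2 E1 = 0"
      using that by (auto simp: sym_zero_def add_eq_0_iff)
    have "x * d F1 F1 E1 = 0" "x * d F2 F2 E1 = 0" using B(1,4) by (simp_all add: c0)
    moreover have "x * (d F1 F2 E1 + d F2 F1 E1) = 0" unfolding distrib_left B(2,3) by (simp add: c0)
    ultimately show ?thesis using x by (simp add: sym_zero_def)
  qed
  have alt: "x * alt_part d = (p * t - q * r) * alt_part c"
    unfolding alt_part_def using B(2,3) by algebra
  then show "alt_part c = 0 \<longleftrightarrow> alt_part d = 0" using x D by (metis mult_eq_0_iff)
  have disc: "x\<^sup>2 * discr d = (p * t - q * r)\<^sup>2 * discr c"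
    unfolding discr_def using B by algebra
  then show "discr c = 0 \<longleftrightarrow> discr d = 0" using x D by (metis mult_eq_0_iff power_not_zero)
  have "x\<^sup>2 * (discr c * (alt_part d)\<^sup>2) = discr c * (x * alt_part d)\<^sup>2"
    by (simp add: power_mult_distrib)
  also have "\<dots> = (x\<^sup>2 * discr d) * (alt_part c)\<^sup>2"
    unfolding alt disc by (simp add: power_mult_distrib)
  finally show "discr c * (alt_part d)\<^sup>2 = discr d * (alt_part c)\<^sup>2" using x by simp
qed

section \<open>Invariants of the listed superalgebras\<close>

lemma sym_zero_table: "admissible c \<alpha> \<Longrightarrow> sym_zero (coef (table c \<alpha>)) \<longleftrightarrow>
    (if c = R01 then \<alpha> = 3 else if c = R04 then \<alpha> = 0
     else c \<notin> {R02, R03, R05, R07, R08, R12, R16, R18, R21, R25, R26, R28})"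
  by (cases c) (simp_all add: sym_zero_def coef_def admissible_def add_eq_0_iff2 flip: diff_divide_distrib)

lemma alt_part_table:
  assumes "admissible c \<alpha>"
  shows "alt_part (coef (table c \<alpha>)) = (if c \<in> {R01, R02, R03, R04, R05} then 2 else 0)"
proof (cases "c = R01")
  case True
  with assms have "\<alpha> + 1 \<noteq> 0" by (simp add: admissible_def add_eq_0_iff2)
  with True show ?thesis by (simp add: alt_part_def coef_def divide_simps)
next
  case False
  then show ?thesis by (cases c) (simp_all add: alt_part_def coef_def)
qed

lemma discr_table: "discr (coef (table c \<alpha>)) =
    (if c = R01 then (2 * (\<alpha> - 3) / (\<alpha> + 1))\<^sup>2 else if c = R04 then 4 * \<alpha>\<^sup>2
     else if c \<in> {R03, R08, R25} then 4 else 0)"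
  by (cases c) (simp_all add: discr_def coef_def power_mult_distrib flip: diff_divide_distrib)

text \<open>Separates the 28 classes. The guards make every entry independent of the parameter: the
  symmetric part of \<open>B\<close> vanishes for \<open>R01\<close> at \<open>\<alpha> = 3\<close>
  and for \<open>R04\<close> at \<open>\<alpha> = 0\<close>, and the last entry is still false
  there, as in the rest of these families.\<close>

definition signature :: "(b3 \<Rightarrow> b3 \<Rightarrow> b3 \<Rightarrow> complex) \<Rightarrow> bool list" where
  "signature T = [T E1 E1 E1 \<noteq> 0,
    T E1 E1 E1 \<noteq> 0 \<and> trace_left T = 2 * T E1 E1 E1,
    T E1 E1 E1 = 0 \<and> lin_rel T 1 0 0 \<and> lin_rel T 0 1 0,
    T E1 E1 E1 = 0 \<and> lin_rel T 1 1 0,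
    T E1 E1 E1 \<noteq> 0 \<and> lin_rel T 1 0 0,
    T E1 E1 E1 \<noteq> 0 \<and> lin_rel T 0 1 0,
    T E1 E1 E1 \<noteq> 0 \<and> lin_rel T 1 0 (- 1),
    T E1 E1 E1 \<noteq> 0 \<and> lin_rel T 0 1 (- 1),
    T E1 E1 E1 \<noteq> 0 \<and> lin_rel T 1 (- 1) 0,
    T E1 E1 E1 \<noteq> 0 \<and> lin_rel T 1 1 (- 1),
    alt_part T \<noteq> 0,
    alt_part T = 0 \<and> sym_zero T,
    alt_part T = 0 \<and> discr T \<noteq> 0,
    alt_part T \<noteq> 0 \<and> discr T = 0 \<and> \<not> sym_zero T]"

lemma signature_table:
  assumes "admissible c \<alpha>"
  shows "signature (coef (table c \<alpha>)) = map (\<lambda>S. c \<in> S)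
   [{R09, R10, R11, R12, R13, R14, R15, R16, R17, R18, R19, R20, R21, R22, R23, R24},
    {R13, R14, R23, R24},
    {R04, R05, R25, R26},
    {R03, R04, R05, R25, R26, R27, R28},
    {R09, R19, R22},
    {R11, R12, R19, R23},
    {R13, R23, R24},
    {R15, R16, R22, R24},
    {R17, R18, R19, R24},
    {R20, R21, R22, R23},
    {R01, R02, R03, R04, R05},
    {R06, R09, R10, R11, R13, R14, R15, R17, R19, R20, R22, R23, R24, R27},
    {R08, R25},
    {R02, R05}]"
proof -
  \<comment> \<open>The numbers \<open>1 + \<alpha>\<close> and \<open>1 - \<alpha>\<close> are
    never both zero, so \<open>L\<close> and \<open>R\<close> do not both vanish in
    \<open>R01\<close>, \<open>R06\<close> and \<open>R07\<close>.\<close>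
  have [simp]: "1 + \<alpha> = 0 \<longrightarrow> \<alpha> \<noteq> 1"
    by auto
  have "\<alpha> + 1 \<noteq> 0" if "c = R01"
    using assms that by (simp add: admissible_def add_eq_0_iff2)
  then show ?thesis
    unfolding signature_def discr_table alt_part_table[OF assms] sym_zero_table[OF assms]
    by (cases c; simp add: lin_rel_def trace_left_def coef_def)
qed

text \<open>The implications for \<open>lin_rel\<close> and \<open>sym_zero\<close> go one way along
  a base change, hence the pair of opposite ones.\<close>

lemma signature_base_change:
  assumes "base_change c d x p q r t" "base_change d c x' p' q' r' t'"
  shows "signature c = signature d"
proof -
  note inv = base_change_invariants[OF assms(1)] and inv' = base_change_invariants[OF assms(2)]
  have "lin_rel c a b k \<longleftrightarrow> lin_rel d a b k" for a b k
    using inv(2) inv'(2) by blast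
  moreover have "sym_zero c \<longleftrightarrow> sym_zero d"
    using inv(4) inv'(4) by blast
  moreover have "c E1 E1 E1 \<noteq> 0 \<and> trace_left c = 2 * c E1 E1 E1 \<longleftrightarrow>
      d E1 E1 E1 \<noteq> 0 \<and> trace_left d = 2 * d E1 E1 E1"
    using inv(1,3) by auto
  ultimately show ?thesis
    unfolding signature_def using inv(1,5,6) by simp
qed

text \<open>The signature determines the class. The parameter is then recovered from the ratio of
  \<open>L\<close> to \<open>R\<close> in \<open>R01\<close>, \<open>R06\<close>,
  \<open>R07\<close>, and up to sign in \<open>R04\<close>, where \<open>discr\<close> over the
  square of \<open>alt_part\<close> is \<open>\<alpha> * \<alpha>\<close>.\<close>

lemma table_isomorphic_iff:
  assumes adm: "admissible c \<alpha>" "admissible d \<beta>"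
  shows "superalgebra_isomorphic cscale (Rmult c \<alpha>) even3 odd3 cscale (Rmult d \<beta>) even3 odd3
    \<longleftrightarrow> c = d \<and> (\<alpha> = \<beta> \<or> (c = R04 \<and> \<beta> = - \<alpha>))"
    (is "?iso \<longleftrightarrow> _")
proof
  assume ?iso
  let ?c = "coef (table c \<alpha>)" and ?d = "coef (table d \<beta>)"
  obtain x p q r t where bc: "base_change ?c ?d x p q r t"
    using iso_imp_base_change[OF graded_table graded_table] \<open>?iso\<close> unfolding Rmult_eq_cmult by metis
  obtain x' p' q' r' t' where bc': "base_change ?d ?c x' p' q' r' t'"
    using iso_imp_base_change[OF graded_table graded_table] superalgebra_isomorphic_sym[OF \<open>?iso\<close>]
    unfolding Rmult_eq_cmult by metis
  have "signature ?c = signature ?d"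
    using bc bc' by (rule signature_base_change)
  then have cd: "c = d"
    unfolding signature_table[OF adm(1)] signature_table[OF adm(2)]
    by (cases c; simp; cases d; simp)
  have "\<alpha> = \<beta>" if "c \<in> {R01, R06, R07}"
  proof -
    \<comment> \<open>Both operators send \<open>f1\<close> to a multiple of \<open>f2\<close>, with
      factors \<open>1 + \<beta>\<close> and \<open>1 - \<beta>\<close>.\<close>
    have "lin_rel ?d (1 - \<beta>) (- (1 + \<beta>)) 0"
      using that cd by (auto simp: lin_rel_def coef_def algebra_simps)
    then have "lin_rel ?c (1 - \<beta>) (- (1 + \<beta>)) 0" by (rule base_change_invariants(2)[OF bc'])
    then have "(1 - \<beta>) * (1 + \<alpha>) + (- (1 + \<beta>)) * (1 - \<alpha>) = 0"
      using that by (auto simp: lin_rel_def coef_def)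
    then show ?thesis by algebra
  qed
  moreover have "\<alpha> = \<beta> \<or> \<beta> = - \<alpha>" if "c = R04"
    using base_change_invariants(7)[OF bc] that cd
    unfolding discr_table alt_part_table[OF adm(1)] alt_part_table[OF adm(2)]
    by (auto simp: power2_eq_iff)
  moreover have "\<alpha> = \<beta>" if "c \<notin> {R01, R04, R06, R07}"
    using that adm cd by (simp add: admissible_def param_family_def)
  ultimately show "c = d \<and> (\<alpha> = \<beta> \<or> (c = R04 \<and> \<beta> = - \<alpha>))"
    using cd by blast
next
  assume "c = d \<and> (\<alpha> = \<beta> \<or> (c = R04 \<and> \<beta> = - \<alpha>))"
  then consider "c = d" "\<alpha> = \<beta>" | "c = R04" "d = R04" "\<beta> = - \<alpha>" by blast
  then show ?iso
  proof cases
    case 1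
    have "base_change (coef (table c \<alpha>)) (coef (table c \<alpha>)) 1 1 0 0 1"
      by (simp add: base_change_def)
    then show ?thesis
      unfolding 1 Rmult_eq_cmult by (intro base_change_imp_iso graded_table)
  next
    case 2
    \<comment> \<open>Exchanging \<open>f1\<close> and \<open>f2\<close> and negating
      \<open>e\<close> reverses the sign of the parameter.\<close>
    have "base_change (coef (table R04 \<alpha>)) (coef (table R04 (- \<alpha>))) (-1) 0 1 1 0"
      by (simp add: base_change_def coef_def)
    then show ?thesis
      unfolding 2 Rmult_eq_cmult by (intro base_change_imp_iso graded_table)
  qed
qed

section \<open>Classification\<close>

context superalgebra_1_2
begin

text \<open>Reduces each case to coordinates: it remains to compute the known products and to invoke
  the matching result on structure constants. Nontriviality reappears as a nonzero constant.\<close>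

lemma classificationI:
  assumes e: "e \<noteq> 0" "A0 = range (\<lambda>a. s a e)" and fg: "odd_basis f g" and nontrivial: "\<not> trivial_product m"
    and "\<And>c. right_alternative_constants c \<Longrightarrow>
      (\<And>i j u. m (case_b3 e f g i) (case_b3 e f g j) = comb s (case_b3 e f g) u \<Longrightarrow> c i j = u) \<Longrightarrow>
      \<exists>i j k. c i j k \<noteq> 0 \<Longrightarrow> right_alternative_constants.classified c"
  shows "\<exists>a \<alpha>. admissible a \<alpha> \<and> superalgebra_isomorphic s m A0 A1 cscale (Rmult a \<alpha>) even3 odd3"
proof -
  obtain c where c: "right_alternative_constants c"
    "superalgebra_isomorphic s m A0 A1 cscale (cmult c) even3 odd3"
    "\<And>i j. m (case_b3 e f g i) (case_b3 e f g j) = comb s (case_b3 e f g) (c i j)"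
    "\<And>u w. comb s (case_b3 e f g) u = comb s (case_b3 e f g) w \<Longrightarrow> u = w"
    using structure_constants[OF e fg] by blast
  obtain \<phi> where \<phi>: "superalgebra_iso s m A0 A1 cscale (cmult c) even3 odd3 \<phi>"
    using c(2) unfolding superalgebra_isomorphic_def by blast
  have "\<exists>i j k. c i j k \<noteq> 0"
  proof (rule ccontr)
    assume "\<not> ?thesis"
    then have "cmult c u v = 0" for u v by (simp add: fun_eq_iff cmult_def)
    then have "\<phi> (m x y) = \<phi> (m 0 0)" for x y
      using \<phi> by (simp add: superalgebra_iso_def)
    moreover have "inj \<phi>" using \<phi> by (simp add: superalgebra_iso_def bij_is_inj)
    ultimately have "m x y = m 0 0" for x y by (blast dest: injD)
    then show False using nontrivial by (simp add: trivial_product_def bilinear)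
  qed
  moreover have "c i j = u" if "m (case_b3 e f g i) (case_b3 e f g j) = comb s (case_b3 e f g) u" for i j u
    using c(3,4) that by metis
  ultimately have "right_alternative_constants.classified c"
    using assms(5) c(1) by blast
  then show ?thesis
    using superalgebra_isomorphic_trans[OF c(2)]
    unfolding right_alternative_constants.classified_def[OF c(1)] by blast
qed

lemma classification:
  assumes nontrivial: "\<not> trivial_product m"
  shows "\<exists>a \<alpha>. admissible a \<alpha> \<and> superalgebra_isomorphic s m A0 A1 cscale (Rmult a \<alpha>) even3 odd3"
proof -
  obtain e where e: "e \<noteq> 0" "A0 = range (\<lambda>a. s a e)" and ee: "m e e = 0 \<or> m e e = e"
    by (rule even_generator)
  note I = classificationI[OF e _ nontrivial]
  have e0: "e \<in> A0" unfolding e(2) by (rule range_eqI[of _ _ 1]) simp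
  have "A0 \<inter> A1 = {0}" using superalgebra by (simp add: superalgebra_def)
  \<comment> \<open>This selects the minus sign in the identity whenever \<open>e\<close> is one of
    the swapped arguments.\<close>
  with e0 e(1) have e1: "e \<notin> A1" by blast
  have skew: "associator m x e y = - associator m x y e" if "x \<in> A0 \<union> A1" "y \<in> A0 \<union> A1" for x y
    using right_alt[unfolded right_alternative_def, rule_format, of x e y] e0 e1 that by simp
  have R2: "m (m x e) e = m x (m e e)" if "x \<in> A1" for x
  proof -
    have "associator m x e e = 0" using skew[of x e] that e0 by (intro eq_neg_imp_zero) simp
    then show ?thesis by (simp add: associator_def)
  qed
  have L2: "m (m e e) x - m e (m e x) = m e (m x e) - m (m e x) e" if "x \<in> A1" for x
    using skew[of e x] that e0 by (simp add: associator_def)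
  have closedR: "m x e \<in> A1" and closedL: "m e x \<in> A1" if "x \<in> A1" for x
    using that e0 by (simp_all add: closed)
  from ee show ?thesis
  proof
    assume e2: "m e e = e"
    have diagonal: ?thesis if \<rho>: "\<rho> = 0 \<or> \<rho> = 1" and R: "\<And>x. x \<in> A1 \<Longrightarrow> m x e = s \<rho> x" for \<rho>
    proof -
      \<comment> \<open>A scalar \<open>R\<close> commutes with \<open>L\<close>, so the identity
        reduces to \<open>L L = L\<close>.\<close>
      have "m e (m e x) = m e x" if "x \<in> A1" for x
        using L2[OF that] R[OF that] R[OF closedL[OF that]] by (simp add: e2 bilinear)
      then have "(\<forall>x\<in>A1. m e x = 0) \<or> (\<forall>x\<in>A1. m e x = x) \<or> (\<exists>f g. odd_basis f g \<and> m e f = f \<and> m e g = 0)"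
        by (intro odd_basis_idempotent closedL) (simp_all add: bilinear)
      then obtain f g a d where fg: "odd_basis f g" and L: "m e f = s a f" "m e g = s d g"
        and ad: "a = 0 \<and> d = 0 \<or> a = 1 \<and> d = 1 \<or> a = 1 \<and> d = 0"
      proof (elim disjE exE conjE)
        assume "\<forall>x\<in>A1. m e x = 0"
        moreover obtain f g where "odd_basis f g" using odd_basis_exists by blast
        ultimately show ?thesis using that[of f g 0 0] by (simp add: odd_basis_def)
      next
        assume "\<forall>x\<in>A1. m e x = x"
        moreover obtain f g where "odd_basis f g" using odd_basis_exists by blast
        ultimately show ?thesis using that[of f g 1 1] by (simp add: odd_basis_def)
      next
        fix f g assume "odd_basis f g" "m e f = f" "m e g = 0"
        then show ?thesis using that[of f g 1 0] by simp
      qed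
      have R: "m f e = s \<rho> f" "m g e = s \<rho> g" using fg R by (simp_all add: odd_basis_def)
      show ?thesis
      proof (rule I[OF fg])
        fix c assume c: "right_alternative_constants c"
          and eq: "\<And>i j u. m (case_b3 e f g i) (case_b3 e f g j) = comb s (case_b3 e f g) u \<Longrightarrow> c i j = u"
        have "c E1 E1 = case_b3 1 0 0" "c F1 E1 = case_b3 0 \<rho> 0" "c F2 E1 = case_b3 0 0 \<rho>"
          "c E1 F1 = case_b3 0 a 0" "c E1 F2 = case_b3 0 0 d"
          by (rule eq; simp add: comb_def e2 R L)+
        then show "right_alternative_constants.classified c"
          using \<rho> ad by (intro right_alternative_constants.classified_diagonal[OF c, of \<rho> a d]) simp_all
      qed
    qed
    have "(\<forall>x\<in>A1. m x e = 0) \<or> (\<forall>x\<in>A1. m x e = x) \<or> (\<exists>f g. odd_basis f g \<and> m f e = f \<and> m g e = 0)"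
      using R2 by (intro odd_basis_idempotent closedR) (simp_all add: bilinear e2)
    then show ?thesis
    proof (elim disjE exE conjE)
      assume "\<forall>x\<in>A1. m x e = 0"
      then show ?thesis by (intro diagonal[of 0]) simp_all
    next
      assume "\<forall>x\<in>A1. m x e = x"
      then show ?thesis by (intro diagonal[of 1]) simp_all
    next
      fix f g assume fg: "odd_basis f g" and R: "m f e = f" "m g e = 0"
      show ?thesis
      proof (rule I[OF fg])
        fix c assume c: "right_alternative_constants c"
          and eq: "\<And>i j u. m (case_b3 e f g i) (case_b3 e f g j) = comb s (case_b3 e f g) u \<Longrightarrow> c i j = u"
        have "c E1 E1 = case_b3 1 0 0" "c F1 E1 = case_b3 0 1 0" "c F2 E1 = case_b3 0 0 0"
          by (rule eq; simp add: comb_def e2 R)+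
        then show "right_alternative_constants.classified c"
          by (intro right_alternative_constants.classified_rank_one_idempotent[OF c]) simp_all
      qed
    qed
  next
    assume e2: "m e e = 0"
    have "(\<forall>x\<in>A1. m x e = 0) \<or> (\<exists>f g. odd_basis f g \<and> m f e = g \<and> m g e = 0)"
      using R2 by (intro odd_basis_nilpotent closedR) (simp_all add: bilinear e2)
    then show ?thesis
    proof (elim disjE exE conjE)
      fix f g assume fg: "odd_basis f g" and R: "m f e = g" "m g e = 0"
      show ?thesis
      proof (rule I[OF fg])
        fix c assume c: "right_alternative_constants c"
          and eq: "\<And>i j u. m (case_b3 e f g i) (case_b3 e f g j) = comb s (case_b3 e f g) u \<Longrightarrow> c i j = u"
        have "c E1 E1 = case_b3 0 0 0" "c F1 E1 = case_b3 0 0 1" "c F2 E1 = case_b3 0 0 0"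
          by (rule eq; simp add: comb_def e2 R)+
        then show "right_alternative_constants.classified c"
          by (intro right_alternative_constants.classified_right_nilpotent[OF c]) simp_all
      qed
    next
      assume R: "\<forall>x\<in>A1. m x e = 0"
      \<comment> \<open>With \<open>R = 0\<close> and \<open>e e = 0\<close> the identity reduces to
        \<open>L L = 0\<close>.\<close>
      have "m e (m e x) = 0" if "x \<in> A1" for x
        using L2[OF that] R that closedL[OF that] by (simp add: e2 bilinear)
      then have "(\<forall>x\<in>A1. m e x = 0) \<or> (\<exists>f g. odd_basis f g \<and> m e f = g \<and> m e g = 0)"
        by (intro odd_basis_nilpotent closedL) (simp_all add: bilinear)
      then show ?thesis
      proof (elim disjE exE conjE)
        fix f g assume fg: "odd_basis f g" and L: "m e f = g" "m e g = 0"
        have R: "m f e = 0" "m g e = 0" using R fg by (simp_all add: odd_basis_def)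
        show ?thesis
        proof (rule I[OF fg])
          fix c assume c: "right_alternative_constants c"
            and eq: "\<And>i j u. m (case_b3 e f g i) (case_b3 e f g j) = comb s (case_b3 e f g) u \<Longrightarrow> c i j = u"
          have "c E1 E1 = case_b3 0 0 0" "c F1 E1 = case_b3 0 0 0" "c F2 E1 = case_b3 0 0 0"
            "c E1 F1 = case_b3 0 0 1" "c E1 F2 = case_b3 0 0 0"
            by (rule eq; simp add: comb_def e2 R L)+
          then show "right_alternative_constants.classified c"
            by (intro right_alternative_constants.classified_nilpotent[OF c, of 0 1]) simp_all
        qed
      next
        assume L: "\<forall>x\<in>A1. m e x = 0"
        \<comment> \<open>Only the form \<open>B\<close> is left, so the basis is adapted to it
          instead of to an operator.\<close>
        obtain f g where fg: "odd_basis f g" and ff: "m f f = 0"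
          using odd_isotropic[OF e] by blast
        have RL: "m f e = 0" "m g e = 0" "m e f = 0" "m e g = 0"
          using R L fg by (simp_all add: odd_basis_def)
        show ?thesis
        proof (rule I[OF fg])
          fix c assume c: "right_alternative_constants c"
            and eq: "\<And>i j u. m (case_b3 e f g i) (case_b3 e f g j) = comb s (case_b3 e f g) u \<Longrightarrow> c i j = u"
            and nz: "\<exists>i j k. c i j k \<noteq> 0"
          have zeros: "c E1 E1 = case_b3 0 0 0" "c F1 E1 = case_b3 0 0 0" "c F2 E1 = case_b3 0 0 0"
            "c E1 F1 = case_b3 0 0 0" "c E1 F2 = case_b3 0 0 0" "c F1 F1 = case_b3 0 0 0"
            by (rule eq; simp add: comb_def e2 RL ff)+
          obtain i j k where "c i j k \<noteq> 0" using nz by blast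
          then have "c F1 F2 E1 \<noteq> 0 \<or> c F2 F1 E1 \<noteq> 0 \<or> c F2 F2 E1 \<noteq> 0"
            by (cases i; cases j; cases k)
              (simp_all add: zeros right_alternative_constants.zero[OF c])
          then show "right_alternative_constants.classified c"
            by (intro right_alternative_constants.classified_bilinear[OF c]) (simp_all add: zeros)
        qed
      qed
    qed
  qed
qed

end

theorem theoremA1:
  fixes s :: "complex \<Rightarrow> 'a::ab_group_add \<Rightarrow> 'a"
    and m :: "'a \<Rightarrow> 'a \<Rightarrow> 'a"
    and A0 A1 :: "'a set"
  assumes "superalgebra_type s m A0 A1 1 2"
    and "right_alternative m A0 A1"
    and "\<not> trivial_product m"
  shows "(\<exists>c \<alpha>. admissible c \<alpha> \<and>
            superalgebra_isomorphic s m A0 A1 cscale (Rmult c \<alpha>) even3 odd3)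
    \<and> (\<forall>c \<alpha> d \<beta>. admissible c \<alpha> \<longrightarrow> admissible d \<beta> \<longrightarrow>
         (superalgebra_isomorphic cscale (Rmult c \<alpha>) even3 odd3 cscale (Rmult d \<beta>) even3 odd3
          \<longleftrightarrow> c = d \<and> (\<alpha> = \<beta> \<or> (c = R04 \<and> \<beta> = - \<alpha>))))"
proof -
  have "vector_space s"
    using assms(1) by (simp add: superalgebra_type_def superalgebra_def)
  then interpret superalgebra_1_2 s m A0 A1
    using assms by (simp add: superalgebra_1_2_def superalgebra_1_2_axioms_def)
  show ?thesis
    using classification[OF assms(3)] table_isomorphic_iff by blast
qed

end
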